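(* Let $a,b,k$ be positive integers. Consider the $(a:b)$ mindegree-$k$ Maker-PhantomBreaker game on $E(K_n)$. (a) If $b>\frac{2a}{k}$, then there exist a constant $c=c(a,b,k)>0$ and an integer $n_0$ such that for all $n\ge n_0$ Maker has a randomized strategy which, against every strategy of PhantomBreaker, wins with probability at least $c$. (b) If $b\le \frac{2a}{k}$, then Maker has a randomized strategy that wins asymptotically almost surely; that is, for every $n$ large enough there is a randomized strategy for Maker and a number $p_n$ with $p_n\to 1$ as $n\to\infty$ such that, against every strategy of PhantomBreaker, this strategy wins with probability at least $p_n$.
   Context: Maker-PhantomBreaker game. The board is the edge set $E(K_n)$ of the complete graph on $n$ vertices, and there is a family of winning sets (edge sets of certain subgraphs of $K_n$). Initially all edges are unclaimed. Two players, Maker and PhantomBreaker, alternate turns, Maker going first. In an $(a:b)$ game, in each round Maker first makes $a$ moves, one after another, each consisting of attempting to claim one edge of $K_n$; then PhantomBreaker claims $b$ unclaimed edges (all remaining unclaimed edges if fewer than $b$ remain). If the edge Maker attempts to claim is unclaimed, it becomes hers. If it has already been claimed by PhantomBreaker, then that move of Maker is lost (she gets no replacement move) and she learns that this edge belongs to PhantomBreaker. Information: PhantomBreaker has complete information about the game so far (he sees all previous moves of Maker, including failed attempts, but not the outcomes of Maker's future random choices). Maker sees none of PhantomBreaker's moves; her only information about them is the success or failure of her own previous attempts. Maker wins if at some point she has claimed all edges of some winning set; otherwise PhantomBreaker wins. Both players may use randomized strategies, where each decision of PhantomBreaker may depend only on all previous moves of both players (including Maker's failed attempts) and his own randomness,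 and each decision of Maker may depend only on her own previous attempts, their success or failure, and her own randomness. Mindegree-$k$ game: the winning sets are the edge sets of all spanning subgraphs of $K_n$ with minimum degree $k$ (equivalently, Maker wins iff every vertex eventually has degree at least $k$ in the graph of Maker's claimed edges). *)

theory Defs
  imports "HOL-Probability.Probability"
begin

type_synonym edge = "nat set"

definition complete_edges :: "nat \<Rightarrow> edge set" where
  "complete_edges n = {e. e \<subseteq> {..<n} \<and> card e = 2}"

definition edge_degree :: "edge set \<Rightarrow> nat \<Rightarrow> nat" where
  "edge_degree F v = card {e \<in> F. v \<in> e}"

definition mindegree_family :: "nat \<Rightarrow> nat \<Rightarrow> edge set set" where
  "mindegree_family n k =
     {F. F \<subseteq> complete_edges n \<and> Min (edge_degree F ` {..<n}) = k}"

(* Attempt e r: Maker attempts to claim e, successfully iff r.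
   Claim F: PhantomBreaker claims all the edges of F, his choice for one round.
   Histories list the newest event first. *)
datatype event = Attempt edge bool | Claim "edge set"

type_synonym history = "event list"

definition maker_edges :: "history \<Rightarrow> edge set" where
  "maker_edges h = {e. Attempt e True \<in> set h}"

definition breaker_edges :: "history \<Rightarrow> edge set" where
  "breaker_edges h = \<Union>{F. Claim F \<in> set h}"

definition unclaimed :: "nat \<Rightarrow> history \<Rightarrow> edge set" where
  "unclaimed n h = complete_edges n - (maker_edges h \<union> breaker_edges h)"

(* Maker's information: her own attempts and their outcomes, newest first. *)
fun maker_view :: "history \<Rightarrow> (edge \<times> bool) list" where
  "maker_view [] = []"
| "maker_view (Attempt e r # h) = (e, r) # maker_view h"
| "maker_view (Claim F # h) = maker_view h"

(* Pure strategies; the players' randomness is added below. *)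
type_synonym maker_strategy = "(edge \<times> bool) list \<Rightarrow> edge"
type_synonym breaker_strategy = "history \<Rightarrow> edge set"

(* Maker may attempt any edge, including one she knows to be PhantomBreaker's,
   but not one she already owns, unless she owns the whole board. *)
definition maker_strategies :: "nat \<Rightarrow> maker_strategy set" where
  "maker_strategies n =
     {s. \<forall>w. s w \<in> complete_edges n \<and>
           ((s w, True) \<in> set w \<longrightarrow> (\<forall>e\<in>complete_edges n. (e, True) \<in> set w))}"

definition breaker_strategies :: "nat \<Rightarrow> nat \<Rightarrow> breaker_strategy set" where
  "breaker_strategies n b =
     {t. \<forall>h. t h \<subseteq> unclaimed n h \<and> card (t h) = min b (card (unclaimed n h))}"

definition maker_step :: "maker_strategy \<Rightarrow> history \<Rightarrow> history" where
  "maker_step s h = (let e = s (maker_view h) in Attempt e (e \<notin> breaker_edges h) # h)"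

definition breaker_step :: "breaker_strategy \<Rightarrow> history \<Rightarrow> history" where
  "breaker_step t h = Claim (t h) # h"

definition game_round :: "nat \<Rightarrow> maker_strategy \<Rightarrow> breaker_strategy \<Rightarrow> history \<Rightarrow> history" where
  "game_round a s t h = breaker_step t ((maker_step s ^^ a) h)"

definition play :: "nat \<Rightarrow> maker_strategy \<Rightarrow> breaker_strategy \<Rightarrow> nat \<Rightarrow> history" where
  "play a s t r = (game_round a s t ^^ r) []"

(* Maker's edge set only grows, so it suffices to inspect it at the ends of rounds.
   Once the board is exhausted, further rounds do not change ownership. *)
definition maker_wins ::
    "edge set set \<Rightarrow> nat \<Rightarrow> maker_strategy \<Rightarrow> breaker_strategy \<Rightarrow> bool" where
  "maker_wins W a s t \<longleftrightarrow> (\<exists>r. \<exists>F\<in>W. F \<subseteq> maker_edges (play a s t r))"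

(* A randomized strategy is a random pure strategy: the player's private randomness
   is drawn in advance, independently of the opponent's, and never revealed.  As only
   finitely many histories matter on a finite board, discrete distributions suffice. *)
definition randomized_maker_strategies :: "nat \<Rightarrow> maker_strategy pmf set" where
  "randomized_maker_strategies n = {\<sigma>. set_pmf \<sigma> \<subseteq> maker_strategies n}"

definition randomized_breaker_strategies :: "nat \<Rightarrow> nat \<Rightarrow> breaker_strategy pmf set" where
  "randomized_breaker_strategies n b = {\<tau>. set_pmf \<tau> \<subseteq> breaker_strategies n b}"

definition maker_win_prob ::
    "edge set set \<Rightarrow> nat \<Rightarrow> maker_strategy pmf \<Rightarrow> breaker_strategy pmf \<Rightarrow> real" where
  "maker_win_prob W a \<sigma> \<tau> =
     measure_pmf.prob (pair_pmf \<sigma> \<tau>) {(s, t). maker_wins W a s t}"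

end

theory Submission
  imports Defs "HOL-Library.Sublist"
begin

text \<open>
Maker can only lose at a vertex that PhantomBreaker isolates while it is still needy, that is, while
its degree in Maker's graph is below \<open>k\<close>. This takes about \<open>n\<close> of his edges. He sees
everything, but he cannot foresee which vertex Maker is going to serve next; so if Maker
always serves a random needy vertex, the vertices on which he has concentrated are served like any
others.

The proof works with behavioural strategies (kernels), whose plays form a Markov chain, and turns them
into random pure strategies at the end (\<open>map_mixed_eq_chain\<close>). The winning probability is then bounded
from below by explicit potential functions, by backward induction over the attempts; against a
fixed pure strategy of PhantomBreaker this needs no more than averages over finite sets.

For a positive probability, Maker joins a random needy vertex to a random vertex (\<open>spread\<close>). She is
done after a linear number of attempts, in which PhantomBreaker can endanger only boundedly many
vertices. Time is cut into boundedly many short windows. In each window, the boundedly many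
vertices that are endangered at its start are all saved with at least a constant probability
(\<open>window\<close>), and a vertex that becomes endangered later waits for the next window. The product of
these probabilities is a constant (\<open>positive_probability\<close>).

For a probability tending to \<open>1\<close> when \<open>b * k \<le> 2 * a\<close>, Maker must not waste edges: with \<open>k * n / 2\<close>
edges, both ends of each being useful, she leaves PhantomBreaker at most \<open>n\<close> edges. So she joins two
random needy vertices; such an attempt fails with probability of order \<open>1 / n\<close>, and a failure is repaired
at once, so the expected waste is bounded (\<open>card_breaker_waste\<close>, \<open>repair_step\<close>, \<open>pairing_step\<close>). Before
almost all the work is done PhantomBreaker has too few edges to isolate any vertex. When the shortfall
is a small fraction \<open>d1\<close>, a bounded number of vertices is endangered, and as the
needy vertices thin out further, from \<open>d1\<close> to a much smaller \<open>d\<close>, each of them is very likely to be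
picked: its survival probability is at most of order \<open>(d / d1) powr (1 / (4 * k))\<close> (\<open>powr_decay\<close>,
\<open>target_progress\<close>). After that no needy vertex is endangered any more, so little work is left that
spreading completes it before this can change (\<open>spread_phase\<close>), and PhantomBreaker's additional
edges do not matter.
\<close>

section \<open>From kernels to randomized strategies\<close>

type_synonym view = "(edge \<times> bool) list"

text \<open>
A turn is the unit of time of all arguments below: one attempt of Maker, followed by
PhantomBreaker's claim when that attempt is the last one of its round. The number of attempts
made so far is the length of Maker's view, so the position inside the round need not be stored.
\<close>

definition turn :: "nat \<Rightarrow> breaker_strategy \<Rightarrow> edge \<Rightarrow> history \<Rightarrow> history" where
  "turn a t e h = (let h' = Attempt e (e \<notin> breaker_edges h) # h in
     if a dvd length (maker_view h') then breaker_step t h' else h')"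

definition advance :: "nat \<Rightarrow> maker_strategy \<Rightarrow> breaker_strategy \<Rightarrow> history \<Rightarrow> history" where
  "advance a s t h = turn a t (s (maker_view h)) h"

lemma maker_view_turn:
  "maker_view (turn a t e h) = (e, e \<notin> breaker_edges h) # maker_view h"
  by (simp add: turn_def Let_def breaker_step_def)

lemma maker_edges_Cons:
  "maker_edges (Attempt e r # h) = (if r then insert e (maker_edges h) else maker_edges h)"
  "maker_edges (Claim F # h) = maker_edges h"
  by (auto simp: maker_edges_def)

lemma breaker_edges_Cons:
  "breaker_edges (Attempt e r # h) = breaker_edges h"
  "breaker_edges (Claim F # h) = F \<union> breaker_edges h"
  by (auto simp: breaker_edges_def)

lemma maker_edges_turn:
  "maker_edges (turn a t e h) =
     (if e \<in> breaker_edges h then maker_edges h else insert e (maker_edges h))"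
  by (simp add: turn_def Let_def breaker_step_def maker_edges_Cons)

lemma maker_edges_conv_view: "maker_edges h = {e. (e, True) \<in> set (maker_view h)}"
  by (induction h rule: maker_view.induct) (auto simp: maker_edges_def)

lemma length_view_advance:
  "length (maker_view ((advance a s t ^^ j) h)) = length (maker_view h) + j"
  by (induction j) (auto simp: advance_def maker_view_turn)

lemma advance_eq:
  "advance a s t h = (if a dvd Suc (length (maker_view h))
     then breaker_step t (maker_step s h) else maker_step s h)"
  by (simp add: advance_def turn_def maker_step_def Let_def)

text \<open>
PhantomBreaker replies only to the last of the \<open>a\<close> attempts, because the number of attempts at
the start of the round is a multiple of \<open>a\<close>.
\<close>

lemma game_round_eq_advance:
  assumes "a > 0" and "a dvd length (maker_view h)"
  shows "game_round a s t h = (advance a s t ^^ a) h"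
proof -
  have steps: "(advance a s t ^^ j) h = (maker_step s ^^ j) h" if "j < a" for j
    using that
  proof (induction j)
    case (Suc j)
    have "length (maker_view ((maker_step s ^^ j) h)) = length (maker_view h) + j"
      using length_view_advance[where s=s and t=t and j=j and h=h and a=a] Suc by simp
    moreover have "\<not> a dvd Suc (length (maker_view h) + j)"
      using assms(2) Suc.prems by (metis add_Suc_right dvd_add_right_iff nat_dvd_not_less zero_less_Suc)
    ultimately show ?case
      using Suc by (simp add: advance_eq)
  qed simp
  obtain j where j: "a = Suc j" using assms(1) gr0_implies_Suc by blast
  have len: "length (maker_view ((maker_step s ^^ j) h)) = length (maker_view h) + j"
    using length_view_advance[where s=s and t=t and j=j and h=h and a=a] steps[of j] j by simp
  have "(advance a s t ^^ a) h = advance a s t ((maker_step s ^^ j) h)"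
    using steps[of j] j by simp
  also have "\<dots> = breaker_step t (maker_step s ((maker_step s ^^ j) h))"
  proof -
    have "a dvd length (maker_view h) + a"
      using assms(2) by simp
    then have "a dvd Suc (length (maker_view h) + j)"
      by (simp only: j add_Suc_right)
    then show ?thesis
      using len by (simp only: advance_eq if_True)
  qed
  finally show ?thesis
    by (simp add: game_round_def j)
qed

lemma play_eq_advance:
  assumes "a > 0"
  shows "play a s t r = (advance a s t ^^ (a * r)) []"
proof (induction r)
  case (Suc r)
  have "play a s t (Suc r) = game_round a s t (play a s t r)"
    by (simp add: play_def)
  also have "\<dots> = (advance a s t ^^ a) ((advance a s t ^^ (a * r)) [])"
    using game_round_eq_advance[OF assms, where h="(advance a s t ^^ (a * r)) []" and s=s and t=t] Suc
    by (simp add: length_view_advance)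
  also have "\<dots> = (advance a s t ^^ (a * Suc r)) []"
    by (simp add: funpow_add)
  finally show ?case .
qed (simp add: play_def)

lemma maker_edges_advance_mono:
  assumes "i \<le> j"
  shows "maker_edges ((advance a s t ^^ i) h) \<subseteq> maker_edges ((advance a s t ^^ j) h)"
  using assms by (induction rule: dec_induct) (auto simp: advance_def maker_edges_turn)

lemma advance_cong:
  assumes "\<And>w. suffix (maker_view h) w \<Longrightarrow> s w = s' w"
  shows "(advance a s t ^^ N) h = (advance a s' t ^^ N) h"
  using assms
proof (induction N arbitrary: h)
  case (Suc N)
  have eq: "advance a s t h = advance a s' t h"
    using Suc.prems by (simp add: advance_def)
  have "(advance a s t ^^ N) (advance a s' t h) = (advance a s' t ^^ N) (advance a s' t h)"
    by (rule Suc.IH) (auto simp: advance_def maker_view_turn intro!: Suc.prems dest: suffix_ConsD)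
  then show ?case
    by (simp add: funpow_Suc_right eq del: funpow.simps)
qed simp

text \<open>
Maker's behaviour is a kernel: her view and a memory value determine the distribution of the next
edge, drawn together with the next memory value. The strategies used here remember the vertex
that they were serving.
\<close>

type_synonym 'm kernel = "view \<Rightarrow> 'm \<Rightarrow> (edge \<times> 'm) pmf"

fun chain :: "nat \<Rightarrow> breaker_strategy \<Rightarrow> 'm kernel \<Rightarrow> nat \<Rightarrow> 'm \<Rightarrow> history \<Rightarrow> history pmf" where
  "chain a t K 0 m h = return_pmf h"
| "chain a t K (Suc N) m h =
     bind_pmf (K (maker_view h) m) (\<lambda>(e, m'). chain a t K N m' (turn a t e h))"

text \<open>
A pure strategy is a decision tree. Grafting one tree below the answer "success" and another one
below the answer "failure" is what makes it possible to draw all of Maker's random choices in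
advance.
\<close>

definition branch :: "view \<Rightarrow> edge \<Rightarrow> maker_strategy \<Rightarrow> maker_strategy \<Rightarrow> maker_strategy" where
  "branch w e s1 s2 = (\<lambda>w'. if w' = w then e else if suffix ((e, True) # w) w' then s1 w' else s2 w')"

fun mixed :: "maker_strategy \<Rightarrow> 'm kernel \<Rightarrow> nat \<Rightarrow> view \<Rightarrow> 'm \<Rightarrow> maker_strategy pmf" where
  "mixed s0 K 0 w m = return_pmf s0"
| "mixed s0 K (Suc N) w m =
     bind_pmf (K w m) (\<lambda>(e, m').
       bind_pmf (mixed s0 K N ((e, True) # w) m') (\<lambda>s1.
         bind_pmf (mixed s0 K N ((e, False) # w) m') (\<lambda>s2.
           return_pmf (branch w e s1 s2))))"

lemma advance_branch:
  assumes "w = maker_view h"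
  shows "(advance a (branch w e s1 s2) t ^^ Suc N) h =
    (if e \<in> breaker_edges h then (advance a s2 t ^^ N) (turn a t e h)
     else (advance a s1 t ^^ N) (turn a t e h))"
proof -
  have 1: "advance a (branch w e s1 s2) t h = turn a t e h"
    by (simp add: advance_def branch_def assms)
  show ?thesis
  proof (cases "e \<in> breaker_edges h")
    case True
    have "branch w e s1 s2 w' = s2 w'" if "suffix ((e, False) # w) w'" for w'
      using that suffix_length_le[OF that] by (auto simp: branch_def suffix_def)
    then have "(advance a (branch w e s1 s2) t ^^ N) (turn a t e h) =
        (advance a s2 t ^^ N) (turn a t e h)"
      by (intro advance_cong) (simp add: maker_view_turn True assms)
    then show ?thesis
      by (simp add: funpow_Suc_right 1 True del: funpow.simps)
  next
    case False
    have "branch w e s1 s2 w' = s1 w'" if "suffix ((e, True) # w) w'" for w'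
      using that suffix_length_le[OF that] by (auto simp: branch_def)
    then have "(advance a (branch w e s1 s2) t ^^ N) (turn a t e h) =
        (advance a s1 t ^^ N) (turn a t e h)"
      by (intro advance_cong) (simp add: maker_view_turn False assms)
    then show ?thesis
      by (simp add: funpow_Suc_right 1 False del: funpow.simps)
  qed
qed

text \<open>
Drawing the choices in advance does not change the law of the play: a play follows only one of the
two subtrees, and the independent draw made for the other one integrates out.
\<close>

lemma map_mixed_eq_chain:
  "map_pmf (\<lambda>s. (advance a s t ^^ N) h) (mixed s0 K N (maker_view h) m) = chain a t K N m h"
proof (induction N arbitrary: h m)
  case (Suc N)
  let ?w = "maker_view h"
  have "bind_pmf (mixed s0 K N ((e, True) # ?w) m') (\<lambda>s1.
         bind_pmf (mixed s0 K N ((e, False) # ?w) m') (\<lambda>s2.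
           return_pmf ((advance a (branch ?w e s1 s2) t ^^ Suc N) h))) =
        chain a t K N m' (turn a t e h)" for e m'
  proof (cases "e \<in> breaker_edges h")
    case True
    show ?thesis
      unfolding advance_branch[OF refl]
      using Suc.IH[where h="turn a t e h" and m=m'] True
      by (simp add: maker_view_turn map_pmf_def)
  next
    case False
    show ?thesis
      unfolding advance_branch[OF refl]
      using Suc.IH[where h="turn a t e h" and m=m'] False
      by (simp add: maker_view_turn map_pmf_def)
  qed
  then show ?case
    by (simp add: map_bind_pmf case_prod_unfold del: funpow.simps cong: bind_pmf_cong)
qed simp

definition legal :: "nat \<Rightarrow> view \<Rightarrow> edge \<Rightarrow> bool" where
  "legal n w e \<longleftrightarrow> e \<in> complete_edges n \<and>
     ((e, True) \<in> set w \<longrightarrow> (\<forall>e'\<in>complete_edges n. (e', True) \<in> set w))"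

lemma maker_strategies_legal: "maker_strategies n = {s. \<forall>w. legal n w (s w)}"
  by (simp add: maker_strategies_def legal_def)

definition spare_edge :: "nat \<Rightarrow> view \<Rightarrow> edge" where
  "spare_edge n w = (SOME e. legal n w e)"

lemma legal_spare_edge:
  assumes "n \<ge> 2"
  shows "legal n w (spare_edge n w)"
proof -
  have "{0, 1} \<in> complete_edges n"
    using assms by (auto simp: complete_edges_def)
  then have "\<exists>e. legal n w e"
    unfolding legal_def by blast
  then show ?thesis
    unfolding spare_edge_def by (rule someI_ex)
qed

lemma mixed_legal:
  assumes "s0 \<in> maker_strategies n"
    and "\<And>w m e m'. (e, m') \<in> set_pmf (K w m) \<Longrightarrow> legal n w e"
  shows "set_pmf (mixed s0 K N w m) \<subseteq> maker_strategies n"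
proof (induction N arbitrary: w m)
  case (Suc N)
  show ?case
  proof
    fix s assume "s \<in> set_pmf (mixed s0 K (Suc N) w m)"
    then obtain e m' s1 s2 where em: "(e, m') \<in> set_pmf (K w m)"
      and s1: "s1 \<in> set_pmf (mixed s0 K N ((e, True) # w) m')"
      and s2: "s2 \<in> set_pmf (mixed s0 K N ((e, False) # w) m')"
      and s: "s = branch w e s1 s2"
      by auto
    show "s \<in> maker_strategies n"
      using assms(2)[OF em] subsetD[OF Suc.IH s1] subsetD[OF Suc.IH s2]
      unfolding s maker_strategies_legal branch_def by auto
  qed
qed (use assms in auto)

lemma prob_bind_pmf:
  "measure_pmf.prob (bind_pmf M f) X = measure_pmf.expectation M (\<lambda>x. measure_pmf.prob (f x) X)"
proof -
  have "ennreal (measure_pmf.prob (bind_pmf M f) X) = (\<integral>\<^sup>+x. emeasure (f x) X \<partial>M)"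
    by (simp flip: measure_pmf.emeasure_eq_measure)
  also have "\<dots> = (\<integral>\<^sup>+x. ennreal (measure_pmf.prob (f x) X) \<partial>M)"
    by (simp add: measure_pmf.emeasure_eq_measure)
  also have "\<dots> = ennreal (measure_pmf.expectation M (\<lambda>x. measure_pmf.prob (f x) X))"
    by (intro nn_integral_eq_integral measure_pmf.integrable_const_bound[where B=1]) auto
  finally show ?thesis
    by (simp add: Bochner_Integration.integral_nonneg)
qed

text \<open>
PhantomBreaker's randomness is independent of Maker's, so a bound against every pure strategy of
his carries over to his randomized strategies.
\<close>

lemma prob_pair_ge:
  assumes "\<And>t. t \<in> set_pmf \<tau> \<Longrightarrow> p \<le> measure_pmf.prob \<sigma> {s. Q s t}"
  shows "p \<le> measure_pmf.prob (pair_pmf \<sigma> \<tau>) {(s, t). Q s t}"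
proof -
  have "pair_pmf \<sigma> \<tau> = bind_pmf \<tau> (\<lambda>t. map_pmf (\<lambda>s. (s, t)) \<sigma>)"
    unfolding pair_pmf_def map_pmf_def by (rule bind_commute_pmf)
  then have "measure_pmf.prob (pair_pmf \<sigma> \<tau>) {(s, t). Q s t} =
      measure_pmf.expectation \<tau> (\<lambda>t. measure_pmf.prob \<sigma> {s. Q s t})"
    by (simp add: prob_bind_pmf vimage_def)
  also have "\<dots> \<ge> p"
  proof (rule measure_pmf.integral_ge_const)
    show "integrable \<tau> (\<lambda>t. measure_pmf.prob \<sigma> {s. Q s t})"
      by (intro measure_pmf.integrable_const_bound[where B=1]) auto
  qed (use assms in \<open>simp add: AE_measure_pmf_iff\<close>)
  finally show ?thesis .
qed

section \<open>Degrees, shortfalls and averages\<close>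

lemma finite_complete_edges: "finite (complete_edges n)"
  by (rule finite_subset[of _ "Pow {..<n}"]) (auto simp: complete_edges_def)

lemma pair_in_complete_edges: "{u, x} \<in> complete_edges n \<longleftrightarrow> u < n \<and> x < n \<and> u \<noteq> x"
  by (auto simp: complete_edges_def card_2_iff doubleton_eq_iff)

lemma finite_maker_edges: "finite (maker_edges h)"
proof -
  have "maker_edges h \<subseteq> fst ` set (maker_view h)"
    by (force simp: maker_edges_conv_view)
  then show ?thesis by (rule finite_subset) simp
qed

text \<open>
The handshake lemma, by double counting incidences.
\<close>

lemma sum_edge_degree:
  assumes "F \<subseteq> complete_edges n"
  shows "(\<Sum>v<n. edge_degree F v) = 2 * card F"
proof -
  have fin: "finite F"
    using assms finite_complete_edges finite_subset by blast
  have "(\<Sum>v<n. edge_degree F v) = (\<Sum>v<n. \<Sum>e\<in>F. if v \<in> e then 1 else 0)"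
    using fin by (simp add: edge_degree_def flip: sum.inter_filter)
  also have "\<dots> = (\<Sum>e\<in>F. \<Sum>v<n. if v \<in> e then 1 else 0)"
    by (rule sum.swap)
  also have "\<dots> = (\<Sum>e\<in>F. 2)"
  proof (rule sum.cong[OF refl])
    fix e assume "e \<in> F"
    then have "e \<subseteq> {..<n}" "card e = 2"
      using assms by (auto simp: complete_edges_def)
    moreover from this have "{v \<in> {..<n}. v \<in> e} = e" by auto
    ultimately show "(\<Sum>v<n. if v \<in> e then 1 else 0) = (2::nat)"
      by (simp flip: sum.inter_filter)
  qed
  finally show ?thesis by simp
qed

lemma edge_degree_mono: "F \<subseteq> G \<Longrightarrow> finite G \<Longrightarrow> edge_degree F v \<le> edge_degree G v"
  unfolding edge_degree_def by (rule card_mono) auto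

lemma edge_degree_le_card: "finite F \<Longrightarrow> edge_degree F v \<le> card F"
  unfolding edge_degree_def by (rule card_mono) auto

lemma edge_degree_Un_le:
  assumes "finite F" "finite G"
  shows "edge_degree (G \<union> F) v \<le> edge_degree F v + card G"
proof -
  have "{e \<in> G \<union> F. v \<in> e} \<subseteq> {e \<in> F. v \<in> e} \<union> G" by auto
  then have "card {e \<in> G \<union> F. v \<in> e} \<le> card ({e \<in> F. v \<in> e} \<union> G)"
    using assms by (intro card_mono) auto
  then show ?thesis
    using card_Un_le[of "{e \<in> F. v \<in> e}" G] by (simp add: edge_degree_def)
qed

lemma edge_degree_insert:
  assumes "finite F" "e \<notin> F"
  shows "edge_degree (insert e F) v = edge_degree F v + (if v \<in> e then 1 else 0)"
proof (cases "v \<in> e")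
  case True
  then have "{e' \<in> insert e F. v \<in> e'} = insert e {e' \<in> F. v \<in> e'}" by auto
  then show ?thesis using assms True by (simp add: edge_degree_def)
next
  case False
  then have "{e' \<in> insert e F. v \<in> e'} = {e' \<in> F. v \<in> e'}" by auto
  then show ?thesis using False by (simp add: edge_degree_def)
qed

lemma card_neighbours:
  assumes "F \<subseteq> complete_edges n"
  shows "card {x. {v, x} \<in> F} = edge_degree F v"
proof -
  have "bij_betw (\<lambda>x. {v, x}) {x. {v, x} \<in> F} {e \<in> F. v \<in> e}"
  proof (rule bij_betw_imageI)
    show "inj_on (\<lambda>x. {v, x}) {x. {v, x} \<in> F}"
      by (auto simp: inj_on_def doubleton_eq_iff)
    show "(\<lambda>x. {v, x}) ` {x. {v, x} \<in> F} = {e \<in> F. v \<in> e}"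
    proof
      show "{e \<in> F. v \<in> e} \<subseteq> (\<lambda>x. {v, x}) ` {x. {v, x} \<in> F}"
      proof
        fix e assume e: "e \<in> {e \<in> F. v \<in> e}"
        then have "card e = 2" using assms by (auto simp: complete_edges_def)
        then obtain x y where "e = {x, y}" by (auto simp: card_2_iff)
        then have "e = {v, x} \<or> e = {v, y}" using e by auto
        then show "e \<in> (\<lambda>x. {v, x}) ` {x. {v, x} \<in> F}" using e by blast
      qed
    qed auto
  qed
  then show ?thesis
    unfolding edge_degree_def by (rule bij_betw_same_card)
qed

definition fresh :: "nat \<Rightarrow> edge set \<Rightarrow> nat \<Rightarrow> nat set" where
  "fresh n F v = {x. x < n \<and> x \<noteq> v \<and> {v, x} \<notin> F}"

lemma finite_fresh: "finite (fresh n F v)"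
  by (simp add: fresh_def)

lemma finite_neighbours:
  assumes "F \<subseteq> complete_edges n"
  shows "finite {x. {v, x} \<in> F}"
  by (rule finite_subset[of _ "{..<n}"]) (use assms pair_in_complete_edges in blast, simp)

lemma card_fresh:
  assumes "F \<subseteq> complete_edges n" "v < n"
  shows "card (fresh n F v) + edge_degree F v + 1 = n"
proof -
  have "{..<n} = fresh n F v \<union> insert v {x. {v, x} \<in> F}"
    using assms pair_in_complete_edges by (fastforce simp: fresh_def)
  moreover have "fresh n F v \<inter> insert v {x. {v, x} \<in> F} = {}"
    by (auto simp: fresh_def)
  moreover have "card (insert v {x. {v, x} \<in> F}) = edge_degree F v + 1"
    using assms(1) pair_in_complete_edges[of v v n]
    by (subst card_insert_disjoint) (auto simp: card_neighbours[OF assms(1)] finite_neighbours[OF assms(1)])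
  ultimately have "card {..<n} = card (fresh n F v) + (edge_degree F v + 1)"
    using card_Un_disjoint[of "fresh n F v" "insert v {x. {v, x} \<in> F}"]
    by (simp only: finite_fresh finite_neighbours[OF assms(1)] finite_insert)
  then show ?thesis by simp
qed

text \<open>
The total shortfall of all vertices is the progress measure of the whole proof: it starts at
\<open>k * n\<close>, an attempt lowers it by at most \<open>2\<close>, and Maker is done once it is \<open>0\<close>. Restricted to a set of
endangered vertices, it tells whether these have been saved.
\<close>

definition shortfall :: "nat \<Rightarrow> edge set \<Rightarrow> nat set \<Rightarrow> nat" where
  "shortfall k F S = (\<Sum>v\<in>S. k - edge_degree F v)"

definition needy :: "nat \<Rightarrow> nat \<Rightarrow> edge set \<Rightarrow> nat set" where
  "needy n k F = {v. v < n \<and> edge_degree F v < k}"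

lemma finite_needy: "finite (needy n k F)"
  by (simp add: needy_def)

lemma shortfall_mono:
  assumes "F \<subseteq> G" "finite G"
  shows "shortfall k G S \<le> shortfall k F S"
  unfolding shortfall_def by (intro sum_mono diff_le_mono2 edge_degree_mono assms)

lemma shortfall_insert:
  assumes "finite S" "finite F" "u \<noteq> x" "{u, x} \<notin> F"
  shows "shortfall k F S = shortfall k (insert {u, x} F) S
    + (if u \<in> S \<and> edge_degree F u < k then 1 else 0)
    + (if x \<in> S \<and> edge_degree F x < k then 1 else 0)"
proof -
  have "k - edge_degree F v = (k - edge_degree (insert {u, x} F) v)
      + (if v = u then (if edge_degree F u < k then 1 else 0) else 0)
      + (if v = x then (if edge_degree F x < k then 1 else 0) else 0)" for v
    using assms by (auto simp: edge_degree_insert)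
  then have "shortfall k F S = (\<Sum>v\<in>S. (k - edge_degree (insert {u, x} F) v)
      + (if v = u then (if edge_degree F u < k then 1 else 0) else 0)
      + (if v = x then (if edge_degree F x < k then 1 else 0) else 0))"
    unfolding shortfall_def by (intro sum.cong) auto
  then show ?thesis
    using assms(1) by (auto simp: sum.distrib shortfall_def)
qed

lemma shortfall_eq_0_iff: "finite S \<Longrightarrow> shortfall k F S = 0 \<longleftrightarrow> (\<forall>v\<in>S. k \<le> edge_degree F v)"
  by (simp add: shortfall_def)

lemma shortfall_le_needy: "shortfall k F {..<n} \<le> k * card (needy n k F)"
proof -
  have "shortfall k F {..<n} = shortfall k F (needy n k F)"
    unfolding shortfall_def by (rule sum.mono_neutral_right) (auto simp: needy_def)
  also have "\<dots> \<le> (\<Sum>v\<in>needy n k F. k)"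
    unfolding shortfall_def by (rule sum_mono) simp
  finally show ?thesis by (simp add: mult.commute)
qed

lemma card_needy_le_shortfall: "card (needy n k F) \<le> shortfall k F {..<n}"
proof -
  have "card (needy n k F) = (\<Sum>v\<in>needy n k F. 1)" by simp
  also have "\<dots> \<le> shortfall k F (needy n k F)"
    unfolding shortfall_def by (rule sum_mono) (auto simp: needy_def)
  also have "\<dots> = shortfall k F {..<n}"
    unfolding shortfall_def by (rule sum.mono_neutral_left) (auto simp: needy_def)
  finally show ?thesis .
qed

text \<open>
A winning set has minimum degree exactly \<open>k\<close>. An edge-minimal subgraph among those of minimum degree
at least \<open>k\<close> is one, since deleting an edge lowers each degree by at most \<open>1\<close>.
\<close>

lemma spanning_subgraph_mindegree:
  assumes "F \<subseteq> complete_edges n" "n > 0" "k > 0"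
    and "shortfall k F {..<n} = 0"
  shows "\<exists>G\<in>mindegree_family n k. G \<subseteq> F"
proof -
  have fin: "finite F"
    using assms finite_complete_edges finite_subset by blast
  let ?P = "\<lambda>G. G \<subseteq> F \<and> (\<forall>v<n. k \<le> edge_degree G v)"
  have "?P F" using assms(4) by (simp add: shortfall_eq_0_iff)
  then obtain G where G: "?P G" and least: "\<And>H. ?P H \<Longrightarrow> card G \<le> card H"
    using ex_has_least_nat[of ?P F card] by blast
  have finG: "finite G" using G fin finite_subset by blast
  let ?D = "edge_degree G ` {..<n}"
  have "Min ?D = k"
  proof (rule ccontr)
    assume "Min ?D \<noteq> k"
    moreover have "Min ?D \<ge> k" using G assms(2) by (subst Min_ge_iff) auto
    ultimately have "Min ?D > k" by simp
    then have gt: "edge_degree G v > k" if "v < n" for v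
      using that assms(2) by (subst (asm) Min_gr_iff) auto
    have "edge_degree G 0 > 0" using gt[of 0] assms by simp
    then obtain e where e: "e \<in> G"
      by (auto simp: edge_degree_def card_gt_0_iff)
    have "edge_degree G v \<le> edge_degree (G - {e}) v + 1" for v
      using edge_degree_insert[of "G - {e}" e v] e finG by (simp add: insert_absorb)
    then have "k \<le> edge_degree (G - {e}) v" if "v < n" for v
      using gt[OF that] by (metis Suc_eq_plus1 less_Suc_eq_le order_less_le_trans)
    then have "?P (G - {e})"
      using G by blast
    then have "card G \<le> card (G - {e})" by (rule least)
    then show False using card_Diff1_less[OF finG e] by simp
  qed
  then show ?thesis using G assms(1) by (auto simp: mindegree_family_def)
qed

definition avg :: "'a set \<Rightarrow> ('a \<Rightarrow> real) \<Rightarrow> real" where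
  "avg A f = (\<Sum>x\<in>A. f x) / real (card A)"

lemma avg_mono: "(\<And>x. x \<in> A \<Longrightarrow> f x \<le> g x) \<Longrightarrow> avg A f \<le> avg A g"
  unfolding avg_def by (intro divide_right_mono sum_mono) auto

lemma avg_cong: "(\<And>x. x \<in> A \<Longrightarrow> f x = g x) \<Longrightarrow> avg A f = avg A g"
  unfolding avg_def by (auto intro!: arg_cong2[where f="(/)"] sum.cong)

lemma avg_affine:
  assumes "finite A" "A \<noteq> {}"
  shows "avg A (\<lambda>x. c + d * f x) = c + d * avg A f"
  using assms by (simp add: avg_def sum.distrib add_divide_distrib flip: sum_distrib_left)

lemma avg_indicator:
  assumes "finite A"
  shows "avg A (\<lambda>x. if P x then 1 else 0) = real (card {x \<in> A. P x}) / real (card A)"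
  using assms by (simp add: avg_def flip: sum.inter_filter)

text \<open>
The vertex \<open>u\<close> is kept as the memory, because the edge \<open>{u, x}\<close> does not show which of its ends was
being served.
\<close>

definition pick :: "nat set \<Rightarrow> (nat \<Rightarrow> nat set) \<Rightarrow> (edge \<times> nat) pmf" where
  "pick A P = bind_pmf (pmf_of_set A) (\<lambda>u. map_pmf (\<lambda>x. ({u, x}, u)) (pmf_of_set (P u)))"

lemma set_pick:
  assumes "finite A" "A \<noteq> {}" "\<And>u. u \<in> A \<Longrightarrow> finite (P u) \<and> P u \<noteq> {}"
  shows "set_pmf (pick A P) = {({u, x}, u) | u x. u \<in> A \<and> x \<in> P u}"
  using assms by (auto simp: pick_def)

lemma expectation_pick:
  assumes "finite A" "A \<noteq> {}" "\<And>u. u \<in> A \<Longrightarrow> finite (P u) \<and> P u \<noteq> {}"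
  shows "measure_pmf.expectation (pick A P) f = avg A (\<lambda>u. avg (P u) (\<lambda>x. f ({u, x}, u)))"
proof -
  have "measure_pmf.expectation (pick A P) f =
      (\<Sum>u\<in>A. measure_pmf.expectation (map_pmf (\<lambda>x. ({u, x}, u)) (pmf_of_set (P u))) f / real (card A))"
    unfolding pick_def
    by (subst pmf_expectation_bind_pmf_of_set) (use assms in \<open>auto simp: field_simps\<close>)
  also have "\<dots> = (\<Sum>u\<in>A. avg (P u) (\<lambda>x. f ({u, x}, u)) / real (card A))"
    using assms by (intro sum.cong) (auto simp: integral_pmf_of_set avg_def)
  finally show ?thesis by (simp only: avg_def sum_divide_distrib)
qed

section \<open>The game as a Markov chain\<close>

definition finished :: "nat \<Rightarrow> nat \<Rightarrow> history set" where
  "finished n k = {h. shortfall k (maker_edges h) {..<n} = 0}"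

lemma maker_wins_if_finished:
  assumes "a > 0" "n > 0" "k > 0" "s \<in> maker_strategies n"
    and "(advance a s t ^^ N) [] \<in> finished n k"
  shows "maker_wins (mindegree_family n k) a s t"
proof -
  let ?M = "maker_edges ((advance a s t ^^ N) [])"
  have "maker_edges ((advance a s t ^^ j) []) \<subseteq> complete_edges n" for j
    using assms(4)
  proof (induction j)
    case (Suc j)
    then show ?case
      using assms(4) by (auto simp: advance_def maker_edges_turn maker_strategies_def)
  qed (simp add: maker_edges_def)
  then obtain G where G: "G \<in> mindegree_family n k" "G \<subseteq> ?M"
    using spanning_subgraph_mindegree[of ?M n k] assms by (auto simp: finished_def)
  have "?M \<subseteq> maker_edges (play a s t N)"
    unfolding play_eq_advance[OF assms(1)]
    by (rule maker_edges_advance_mono) (use assms(1) in simp)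
  then show ?thesis
    using G unfolding maker_wins_def by blast
qed

text \<open>
It suffices to play a kernel well against each pure strategy of PhantomBreaker for a fixed
number of attempts.
\<close>

lemma randomized_strategy_from_kernel:
  assumes "a > 0" "n \<ge> 2" "k > 0"
    and legal: "\<And>w m e m'. (e, m') \<in> set_pmf (K w m) \<Longrightarrow> legal n w e"
    and win: "\<And>t. t \<in> breaker_strategies n b \<Longrightarrow>
      p \<le> measure_pmf.prob (chain a t K N m []) (finished n k)"
  shows "\<exists>\<sigma>\<in>randomized_maker_strategies n. \<forall>\<tau>\<in>randomized_breaker_strategies n b.
    p \<le> maker_win_prob (mindegree_family n k) a \<sigma> \<tau>"
proof -
  define \<sigma> where "\<sigma> = mixed (spare_edge n) K N [] m"
  have "spare_edge n \<in> maker_strategies n"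
    using legal_spare_edge[OF assms(2)] by (simp add: maker_strategies_legal)
  then have sub: "set_pmf \<sigma> \<subseteq> maker_strategies n"
    unfolding \<sigma>_def by (rule mixed_legal[OF _ legal])
  have "p \<le> maker_win_prob (mindegree_family n k) a \<sigma> \<tau>"
    if \<tau>: "\<tau> \<in> randomized_breaker_strategies n b" for \<tau>
    unfolding maker_win_prob_def
  proof (rule prob_pair_ge)
    fix t assume "t \<in> set_pmf \<tau>"
    then have t: "t \<in> breaker_strategies n b"
      using \<tau> by (auto simp: randomized_breaker_strategies_def)
    have "chain a t K N m [] = map_pmf (\<lambda>s. (advance a s t ^^ N) []) \<sigma>"
      using map_mixed_eq_chain[where a=a and t=t and N=N and h="[]" and ?s0.0="spare_edge n" and K=K and m=m] by (simp add: \<sigma>_def)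
    then have "p \<le> measure_pmf.prob \<sigma> {s. (advance a s t ^^ N) [] \<in> finished n k}"
      using win[OF t] by (simp add: vimage_def)
    also have "\<dots> \<le> measure_pmf.prob \<sigma> {s. maker_wins (mindegree_family n k) a s t}"
      by (rule measure_pmf.finite_measure_mono_AE)
        (use sub maker_wins_if_finished[OF assms(1) _ assms(3)] assms(2) in \<open>auto simp: AE_measure_pmf_iff\<close>)
    finally show "p \<le> measure_pmf.prob \<sigma> {s. maker_wins (mindegree_family n k) a s t}" .
  qed
  then show ?thesis
    using sub by (auto simp: randomized_maker_strategies_def)
qed

text \<open>
From here on one pure strategy \<open>t\<close> of PhantomBreaker is fixed. No bound obtained below depends on it.
\<close>

locale mindegree_game =
  fixes n a b k :: nat and t :: breaker_strategy and K :: "nat kernel"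
  assumes a_pos: "a > 0" and k_pos: "k > 0" and k_less: "k < n"
    and breaker: "t \<in> breaker_strategies n b"
begin

abbreviation lack :: "history \<Rightarrow> nat" where
  "lack h \<equiv> shortfall k (maker_edges h) {..<n}"

abbreviation alive :: "history \<Rightarrow> nat set" where
  "alive h \<equiv> needy n k (maker_edges h)"

abbreviation blocked :: "history \<Rightarrow> nat \<Rightarrow> nat" where
  "blocked h v \<equiv> edge_degree (breaker_edges h) v"

abbreviation attempts :: "history \<Rightarrow> nat" where
  "attempts h \<equiv> length (maker_view h)"

definition win_prob :: "nat \<Rightarrow> nat \<Rightarrow> history \<Rightarrow> real" where
  "win_prob N m h = measure_pmf.prob (chain a t K N m h) (finished n k)"

lemma win_prob_0: "win_prob 0 m h = (if lack h = 0 then 1 else 0)"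
  by (simp add: win_prob_def finished_def)

lemma win_prob_Suc:
  "win_prob (Suc N) m h = measure_pmf.expectation (K (maker_view h) m)
     (\<lambda>(e, m'). win_prob N m' (turn a t e h))"
  by (simp add: win_prob_def prob_bind_pmf case_prod_unfold)

lemma win_prob_nonneg: "0 \<le> win_prob N m h"
  by (simp add: win_prob_def)

lemma win_prob_le_1: "win_prob N m h \<le> 1"
  by (simp add: win_prob_def)

lemma integrable_win_prob:
  "integrable (measure_pmf M) (\<lambda>(e, m'). win_prob N m' (turn a t e h))"
  by (intro measure_pmf.integrable_const_bound[where B=1])
    (auto simp: case_prod_unfold win_prob_nonneg win_prob_le_1 abs_of_nonneg)

lemma win_prob_finished:
  assumes "lack h = 0"
  shows "win_prob N m h = 1"
  using assms
proof (induction N arbitrary: m h)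
  case (Suc N)
  have "lack (turn a t e h) = 0" for e
  proof -
    have "maker_edges h \<subseteq> maker_edges (turn a t e h)"
      by (auto simp: maker_edges_turn)
    then show ?thesis
      using shortfall_mono[OF _ finite_maker_edges, where F="maker_edges h"] Suc.prems
      by (metis le_zero_eq)
  qed
  then show ?case
    by (simp add: win_prob_Suc Suc.IH case_prod_unfold)
qed (simp add: win_prob_0)

lemma win_prob_mono_time:
  assumes "N \<le> N'"
  shows "win_prob N m h \<le> win_prob N' m h"
  using assms
proof (induction N arbitrary: N' m h)
  case 0
  then show ?case
    by (simp add: win_prob_0 win_prob_finished win_prob_nonneg)
next
  case (Suc N)
  then obtain N'' where "N' = Suc N''" "N \<le> N''"
    by (cases N') auto
  with Suc.IH show ?case
    by (auto simp: win_prob_Suc intro!: integral_mono integrable_win_prob)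
qed

lemma win_prob_pick:
  assumes "K (maker_view h) m = pick A P"
    and "finite A" "A \<noteq> {}" "\<And>u. u \<in> A \<Longrightarrow> finite (P u) \<and> P u \<noteq> {}"
  shows "win_prob (Suc N) m h = avg A (\<lambda>u. avg (P u) (\<lambda>x. win_prob N u (turn a t {u, x} h)))"
  by (simp add: win_prob_Suc assms(1) expectation_pick[OF assms(2-4)])

lemma breaker_claim: "t h \<subseteq> complete_edges n" "card (t h) \<le> b"
  using breaker by (auto simp: breaker_strategies_def unclaimed_def)

lemma breaker_edges_turn:
  "breaker_edges (turn a t e h) =
    (if a dvd Suc (attempts h) then t (Attempt e (e \<notin> breaker_edges h) # h) else {}) \<union> breaker_edges h"
  by (simp add: turn_def Let_def breaker_step_def breaker_edges_Cons)

text \<open>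
The facts about a history that every play from the empty board preserves. The bound on the number of
PhantomBreaker's edges counts complete rounds; this exact count is what the threshold
\<open>b \<le> 2 * a / k\<close> is about.
\<close>

definition valid :: "history \<Rightarrow> bool" where
  "valid h \<longleftrightarrow> maker_edges h \<subseteq> complete_edges n \<and> breaker_edges h \<subseteq> complete_edges n
     \<and> card (breaker_edges h) \<le> b * (attempts h div a)"

lemma valid_Nil: "valid []"
  by (simp add: valid_def maker_edges_def breaker_edges_def)

lemma valid_finite: "valid h \<Longrightarrow> finite (breaker_edges h)"
  using finite_complete_edges finite_subset unfolding valid_def by blast

lemma attempts_turn: "attempts (turn a t e h) = Suc (attempts h)"
  by (simp add: maker_view_turn)

lemma valid_turn:
  assumes "valid h" "e \<in> complete_edges n"
  shows "valid (turn a t e h)"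
proof -
  have "card (breaker_edges (turn a t e h)) \<le> b * (Suc (attempts h) div a)"
  proof (cases "a dvd Suc (attempts h)")
    case True
    then have "Suc (attempts h) div a = Suc (attempts h div a)"
      using a_pos by (simp add: div_Suc dvd_eq_mod_eq_0)
    moreover have "card (breaker_edges (turn a t e h)) \<le> b + card (breaker_edges h)"
      using True card_Un_le[of "t (Attempt e (e \<notin> breaker_edges h) # h)" "breaker_edges h"]
        breaker_claim(2)[of "Attempt e (e \<notin> breaker_edges h) # h"]
      unfolding breaker_edges_turn by simp
    ultimately show ?thesis using assms(1) by (simp add: valid_def)
  next
    case False
    then have "Suc (attempts h) div a = attempts h div a"
      by (simp add: div_Suc dvd_eq_mod_eq_0)
    then show ?thesis using False assms(1) by (simp add: valid_def breaker_edges_turn)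
  qed
  then show ?thesis
    using assms breaker_claim(1) by (auto simp: valid_def maker_edges_turn breaker_edges_turn attempts_turn)
qed

lemma blocked_turn:
  assumes "valid h"
  shows "blocked (turn a t e h) v \<le> blocked h v + b"
proof -
  have "blocked (turn a t e h) v \<le> blocked h v +
      card (if a dvd Suc (attempts h) then t (Attempt e (e \<notin> breaker_edges h) # h) else {})"
    unfolding breaker_edges_turn
    by (rule edge_degree_Un_le[OF valid_finite[OF assms]])
      (auto intro: finite_subset[OF breaker_claim(1)] finite_complete_edges)
  also have "card (if a dvd Suc (attempts h) then t (Attempt e (e \<notin> breaker_edges h) # h) else {}) \<le> b"
    using breaker_claim(2) by simp
  finally show ?thesis by simp
qed

lemma alive_turn: "alive (turn a t e h) \<subseteq> alive h"
proof -
  have "maker_edges h \<subseteq> maker_edges (turn a t e h)"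
    by (auto simp: maker_edges_turn)
  then have "edge_degree (maker_edges h) v \<le> edge_degree (maker_edges (turn a t e h)) v" for v
    by (rule edge_degree_mono) (rule finite_maker_edges)
  then show ?thesis
    unfolding needy_def using le_less_trans by blast
qed

lemma card_breaker_le: "valid h \<Longrightarrow> card (breaker_edges h) \<le> b * attempts h"
  unfolding valid_def using mult_le_mono2[OF div_le_dividend[of "attempts h" a], of b]
  by linarith

lemma few_heavily_blocked:
  assumes "valid h" "c > 0"
  shows "real (card {v. v < n \<and> real (blocked h v) > c}) \<le> 2 * real (card (breaker_edges h)) / c"
proof -
  let ?S = "{v. v < n \<and> real (blocked h v) > c}"
  have "real (card ?S) * c = (\<Sum>v\<in>?S. c)" by simp
  also have "\<dots> \<le> (\<Sum>v\<in>?S. real (blocked h v))"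
    by (rule sum_mono) auto
  also have "\<dots> \<le> (\<Sum>v<n. real (blocked h v))"
    by (rule sum_mono2) auto
  also have "\<dots> = 2 * real (card (breaker_edges h))"
    using sum_edge_degree[of "breaker_edges h" n] assms(1)
    by (simp add: valid_def flip: of_nat_sum)
  finally show ?thesis
    using assms(2) by (simp add: field_simps)
qed

definition blocking :: "history \<Rightarrow> nat \<Rightarrow> nat set \<Rightarrow> real" where
  "blocking h u P = real (card {x \<in> P. {u, x} \<in> breaker_edges h}) / real (card P)"

text \<open>
Only success or failure of the attempt matters for the estimates, so averaging over the second end
of the edge leaves nothing but the fraction of partners that PhantomBreaker has blocked.
\<close>

lemma avg_outcome:
  assumes "finite P" "P \<noteq> {}"
  shows "avg P (\<lambda>x. if {u, x} \<in> breaker_edges h then f else s) = s + (f - s) * blocking h u P"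
proof -
  have "avg P (\<lambda>x. if {u, x} \<in> breaker_edges h then f else s) =
      avg P (\<lambda>x. s + (f - s) * (if {u, x} \<in> breaker_edges h then 1 else 0))"
    by (intro avg_cong) auto
  also have "\<dots> = s + (f - s) * blocking h u P"
    by (simp add: avg_affine[OF assms] avg_indicator[OF assms(1)] blocking_def)
  finally show ?thesis .
qed

lemma blocking_le:
  assumes "valid h"
  shows "blocking h u P \<le> real (blocked h u) / real (card P)"
proof -
  have B: "breaker_edges h \<subseteq> complete_edges n" using assms by (simp add: valid_def)
  have "card {x \<in> P. {u, x} \<in> breaker_edges h} \<le> card {x. {u, x} \<in> breaker_edges h}"
    by (rule card_mono[OF finite_neighbours[OF B]]) auto
  then show ?thesis
    unfolding blocking_def by (intro divide_right_mono) (auto simp: card_neighbours[OF B])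
qed

lemma lack_turn_fail: "{u, x} \<in> breaker_edges h \<Longrightarrow>
    shortfall k (maker_edges (turn a t {u, x} h)) S = shortfall k (maker_edges h) S"
  by (simp add: maker_edges_turn)

lemma shortfall_turn_le:
  "shortfall k (maker_edges (turn a t e h)) S \<le> shortfall k (maker_edges h) S"
  by (rule shortfall_mono) (auto simp: maker_edges_turn finite_maker_edges)

lemma shortfall_turn_success:
  assumes "finite S" "x \<noteq> u" "{u, x} \<notin> maker_edges h" "{u, x} \<notin> breaker_edges h"
  shows "shortfall k (maker_edges h) S = shortfall k (maker_edges (turn a t {u, x} h)) S
    + (if u \<in> S \<and> edge_degree (maker_edges h) u < k then 1 else 0)
    + (if x \<in> S \<and> edge_degree (maker_edges h) x < k then 1 else 0)"
  using shortfall_insert[OF assms(1) finite_maker_edges assms(2)[symmetric] assms(3), of k] assms(4)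
  by (simp add: maker_edges_turn)

end

section \<open>Spreading: serving random needy vertices\<close>

definition owned :: "view \<Rightarrow> edge set" where
  "owned w = {e. (e, True) \<in> set w}"

lemma owned_view: "owned (maker_view h) = maker_edges h"
  by (simp add: owned_def maker_edges_conv_view)

text \<open>
Spreading ignores efficiency: a random needy vertex is joined to a random vertex of the whole board.
The other end has usually no need of the edge, but the attempt is hard to predict.
\<close>

definition spread :: "nat \<Rightarrow> nat \<Rightarrow> view \<Rightarrow> (edge \<times> nat) pmf" where
  "spread n k w =
     (if owned w \<subseteq> complete_edges n \<and> needy n k (owned w) \<noteq> {}
      then pick (needy n k (owned w)) (fresh n (owned w))
      else return_pmf (spare_edge n w, 0))"

lemma card_fresh_needy:
  assumes "F \<subseteq> complete_edges n" "u \<in> needy n k F"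
  shows "n \<le> card (fresh n F u) + k"
  using assms card_fresh[OF assms(1), of u] by (simp add: needy_def)

lemma fresh_needy_nonempty:
  assumes "F \<subseteq> complete_edges n" "u \<in> needy n k F" "k < n"
  shows "finite (fresh n F u) \<and> fresh n F u \<noteq> {}"
  using card_fresh_needy[OF assms(1,2)] assms(3) by (auto simp: finite_fresh)

lemma legal_fresh: "u < n \<Longrightarrow> x \<in> fresh n (owned w) u \<Longrightarrow> legal n w {u, x}"
  by (auto simp: legal_def fresh_def owned_def pair_in_complete_edges)

lemma legal_spread:
  assumes "k < n" "n \<ge> 2" "(e, m) \<in> set_pmf (spread n k w)"
  shows "legal n w e"
proof (cases "owned w \<subseteq> complete_edges n \<and> needy n k (owned w) \<noteq> {}")
  case True
  then have "set_pmf (spread n k w) =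
      {({u, x}, u) | u x. u \<in> needy n k (owned w) \<and> x \<in> fresh n (owned w) u}"
    using fresh_needy_nonempty assms(1)
    by (simp add: spread_def set_pick finite_needy)
  then show ?thesis
    using assms(3) legal_fresh by (auto simp: needy_def)
next
  case False
  then have "spread n k w = return_pmf (spare_edge n w, 0)"
    unfolding spread_def by (rule if_not_P)
  then show ?thesis
    using assms(2,3) legal_spare_edge by simp
qed

text \<open>
The probability that at least \<open>d\<close> of \<open>s\<close> independent trials of success probability \<open>q\<close> succeed. The
recursion by the first trial is the form in which this quantity meets the game.
\<close>

fun hits :: "real \<Rightarrow> nat \<Rightarrow> nat \<Rightarrow> real" where
  "hits q 0 s = 1"
| "hits q (Suc d) 0 = 0"
| "hits q (Suc d) (Suc s) = q * hits q d s + (1 - q) * hits q (Suc d) s"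

lemma hits_bounds:
  assumes "0 \<le> q" "q \<le> 1"
  shows "0 \<le> hits q d s" "hits q d s \<le> 1"
proof -
  have "0 \<le> hits q d s \<and> hits q d s \<le> 1"
  proof (induction s arbitrary: d)
    case 0
    then show ?case by (cases d) auto
  next
    case (Suc s)
    show ?case
    proof (cases d)
      case (Suc d')
      have "q * hits q d' s + (1 - q) * hits q d s \<le> q * 1 + (1 - q) * 1"
        using assms Suc.IH by (intro add_mono mult_left_mono) auto
      then show ?thesis using Suc Suc.IH assms by simp
    qed simp
  qed
  then show "0 \<le> hits q d s" "hits q d s \<le> 1" by auto
qed

lemma hits_Suc_le:
  assumes "0 \<le> q" "q \<le> 1"
  shows "hits q (Suc d) s \<le> hits q d s"
proof (induction s arbitrary: d)
  case 0
  then show ?case using hits_bounds[OF assms] by simp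
next
  case (Suc s)
  show ?case
  proof (cases d)
    case 0
    then show ?thesis using hits_bounds(2)[OF assms, of "Suc d" "Suc s"] by simp
  next
    case (Suc d')
    then show ?thesis
      using assms Suc.IH by (simp add: add_mono mult_left_mono)
  qed
qed

lemma hits_antimono:
  assumes "0 \<le> q" "q \<le> 1" "d \<le> d'"
  shows "hits q d' s \<le> hits q d s"
  using assms(3) by (induction rule: dec_induct) (auto intro: order_trans[OF hits_Suc_le[OF assms(1,2)]])

lemma hits_ge_binomial:
  assumes "0 \<le> q" "q \<le> 1"
  shows "real (s choose d) * q ^ d * (1 - q) ^ s \<le> hits q d s"
proof (induction s arbitrary: d)
  case 0
  then show ?case by (cases d) auto
next
  case (Suc s)
  show ?case
  proof (cases d)
    case 0
    then show ?thesis using assms by (simp add: mult_le_one power_le_one)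
  next
    case (Suc d')
    have "real (Suc s choose d) * q ^ d * (1 - q) ^ Suc s =
       (1 - q) * (q * (real (s choose d') * q ^ d' * (1 - q) ^ s))
       + (1 - q) * (real (s choose d) * q ^ d * (1 - q) ^ s)"
      by (simp add: Suc algebra_simps)
    also have "\<dots> \<le> 1 * (q * hits q d' s) + (1 - q) * hits q d s"
      using assms Suc.IH[of d'] Suc.IH[of d]
      by (intro add_mono mult_mono) (auto simp: hits_bounds)
    also have "\<dots> = hits q d (Suc s)" by (simp add: Suc)
    finally show ?thesis .
  qed
qed

text \<open>
A linear number of trials of success probability of order \<open>1 / n\<close> yields \<open>K\<close> successes with a probability
that does not depend on \<open>n\<close>; the single binomial term for exactly \<open>K\<close> successes shows it.
\<close>

lemma hits_ge_constant:
  assumes "n > 0" "K > 0" "K \<le> s" "s \<le> n" "0 < r" "r * real n \<le> real s" "d \<le> K"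
  shows "(r / (3 * real K)) ^ K / 2 \<le> hits (1 / (3 * real n)) d s"
proof -
  let ?q = "1 / (3 * real n)"
  have q: "0 \<le> ?q" "?q \<le> 1" using assms(1) by auto
  have "(r / (3 * real K)) ^ K \<le> (real s / real K * ?q) ^ K"
    using assms by (intro power_mono) (auto simp: field_simps)
  also have "\<dots> = (real s / real K) ^ K * ?q ^ K"
    by (rule power_mult_distrib)
  also have "\<dots> \<le> real (s choose K) * ?q ^ K"
    using binomial_ge_n_over_k_pow_k[OF assms(3), where 'a=real] q by (intro mult_right_mono) auto
  finally have 1: "(r / (3 * real K)) ^ K \<le> real (s choose K) * ?q ^ K" .
  have "1 + real s * (- ?q) \<le> (1 + (- ?q)) ^ s"
    by (rule Bernoulli_inequality) (use q in linarith)
  moreover have "real s * ?q \<le> 1 / 2"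
    using assms by (simp add: field_simps)
  ultimately have 2: "1 / 2 \<le> (1 - ?q) ^ s" by simp
  have "(r / (3 * real K)) ^ K * (1 / 2) \<le> (real (s choose K) * ?q ^ K) * (1 - ?q) ^ s"
    using 1 2 q assms(5) by (intro mult_mono) auto
  also have "\<dots> \<le> hits ?q K s" by (rule hits_ge_binomial[OF q])
  also have "\<dots> \<le> hits ?q d s" by (rule hits_antimono[OF q assms(7)])
  finally show ?thesis by simp
qed

context mindegree_game
begin

lemma fresh_alive:
  assumes "valid h" "u \<in> alive h"
  shows "finite (fresh n (maker_edges h) u)" "fresh n (maker_edges h) u \<noteq> {}"
    "n \<le> card (fresh n (maker_edges h) u) + k"
  using assms fresh_needy_nonempty[OF _ assms(2) k_less] card_fresh_needy[OF _ assms(2)]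
  by (auto simp: valid_def)

lemma alive_nonempty: "lack h > 0 \<Longrightarrow> alive h \<noteq> {}"
  using shortfall_le_needy[of k "maker_edges h" n] by auto

lemma card_alive_le: "card (alive h) \<le> n"
proof -
  have "card (alive h) \<le> card {..<n}"
    by (rule card_mono) (auto simp: needy_def)
  then show ?thesis by simp
qed

lemma fresh_pair:
  assumes "u \<in> alive h" "x \<in> fresh n (maker_edges h) u"
  shows "{u, x} \<in> complete_edges n" "x \<noteq> u" "{u, x} \<notin> maker_edges h" "x < n" "u < n"
  using assms by (auto simp: needy_def fresh_def pair_in_complete_edges)

text \<open>
A vertex with at most \<open>n / 2\<close> edges of PhantomBreaker is served with probability at least \<open>1 / 3\<close> per
attempt, as at least \<open>n - k\<close> edges at it are still worth trying.
\<close>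

lemma blocking_fresh_le:
  assumes "valid h" "u \<in> alive h" "4 * k \<le> n" "2 * blocked h u \<le> n"
  shows "blocking h u (fresh n (maker_edges h) u) \<le> 2 / 3"
proof -
  let ?c = "card (fresh n (maker_edges h) u)"
  have "?c > 0" using fresh_alive[OF assms(1,2)] by (simp add: card_gt_0_iff)
  have "3 * blocked h u \<le> 2 * ?c"
    using fresh_alive(3)[OF assms(1,2)] assms(3,4) by linarith
  then have "real (blocked h u) / real ?c \<le> 2 / 3"
    using \<open>?c > 0\<close> by (simp add: field_simps)
  then show ?thesis
    using blocking_le[OF assms(1)] order_trans by blast
qed

lemma win_prob_spread_ge:
  assumes "K (maker_view h) m = spread n k (maker_view h)"
    and "valid h" "lack h > 0" "4 * k \<le> n"
    and light: "\<And>u. u \<in> alive h \<Longrightarrow> 2 * blocked h u \<le> n"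
    and fail: "\<And>u x. u \<in> alive h \<Longrightarrow> x \<in> fresh n (maker_edges h) u \<Longrightarrow>
      {u, x} \<in> breaker_edges h \<Longrightarrow> f u \<le> win_prob N u (turn a t {u, x} h)"
    and succ: "\<And>u x. u \<in> alive h \<Longrightarrow> x \<in> fresh n (maker_edges h) u \<Longrightarrow>
      {u, x} \<notin> breaker_edges h \<Longrightarrow> s u \<le> win_prob N u (turn a t {u, x} h)"
    and order: "\<And>u. u \<in> alive h \<Longrightarrow> f u \<le> s u"
  shows "avg (alive h) (\<lambda>u. (s u + 2 * f u) / 3) \<le> win_prob (Suc N) m h"
proof -
  let ?P = "fresh n (maker_edges h)"
  have K: "K (maker_view h) m = pick (alive h) ?P"
    using assms(1-3) alive_nonempty[of h] by (simp add: spread_def owned_view valid_def)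
  have "(s u + 2 * f u) / 3 \<le> avg (?P u) (\<lambda>x. win_prob N u (turn a t {u, x} h))"
    if u: "u \<in> alive h" for u
  proof -
    have "(s u - f u) * blocking h u (?P u) \<le> (s u - f u) * (2 / 3)"
      using blocking_fresh_le[OF assms(2) u assms(4) light[OF u]] order[OF u]
      by (intro mult_left_mono) auto
    moreover have "(s u - f u) * blocking h u (?P u) = - ((f u - s u) * blocking h u (?P u))"
      by (simp add: algebra_simps)
    ultimately have "(s u + 2 * f u) / 3 \<le> s u + (f u - s u) * blocking h u (?P u)"
      by (simp add: field_simps)
    also have "\<dots> = avg (?P u) (\<lambda>x. if {u, x} \<in> breaker_edges h then f u else s u)"
      using fresh_alive[OF assms(2) u] by (simp add: avg_outcome)
    also have "\<dots> \<le> avg (?P u) (\<lambda>x. win_prob N u (turn a t {u, x} h))"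
      by (rule avg_mono) (use fail[OF u] succ[OF u] in auto)
    finally show ?thesis .
  qed
  then have "avg (alive h) (\<lambda>u. (s u + 2 * f u) / 3)
      \<le> avg (alive h) (\<lambda>u. avg (?P u) (\<lambda>x. win_prob N u (turn a t {u, x} h)))"
    by (rule avg_mono)
  also have "\<dots> = win_prob (Suc N) m h"
    using win_prob_pick[OF K finite_needy alive_nonempty[OF assms(3)]] fresh_alive(1,2)[OF assms(2)]
    by simp
  finally show ?thesis .
qed

text \<open>
One window of \<open>s\<close> attempts of spreading, during which the vertices of \<open>Tg\<close> must be saved. Two quantities
are followed at once. While no needy vertex is half blocked, each attempt lowers the total shortfall
with probability at least \<open>1 / 3\<close>, so \<open>2 ^ lack h\<close> shrinks by \<open>5 / 6\<close> in expectation; this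
bounds the risk of running out of time. And each attempt picks a given target and succeeds with
probability at least \<open>1 / (3 * n)\<close>, so saving the targets is at least as likely as collecting that
many successes in \<open>s\<close> trials. The targets are chosen before the window starts, so nothing that
PhantomBreaker does inside it interferes. The hypothesis \<open>exit\<close> says what a window with all targets
saved is worth.
\<close>

lemma window:
  assumes spread: "\<And>h m. valid h \<Longrightarrow> lack h < D \<Longrightarrow> K (maker_view h) m = spread n k (maker_view h)"
    and n: "4 * k \<le> n"
    and C: "0 \<le> C" "C \<le> 1"
    and Tg: "Tg \<subseteq> {..<n}"
    and exit: "\<And>h m. valid h \<Longrightarrow> lack h < D \<Longrightarrow> attempts h = T \<Longrightarrow>
      (\<And>v. v \<in> alive h \<Longrightarrow> blocked h v \<le> Y) \<Longrightarrow> C - 2 ^ lack h * (5/6) ^ N \<le> win_prob N m h"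
    and inv: "valid h" "lack h < D" "attempts h + s = T"
      "\<And>v. v \<in> alive h - Tg \<Longrightarrow> blocked h v + b * s \<le> Y"
      "\<And>v. v \<in> alive h \<Longrightarrow> 2 * (blocked h v + b * s) \<le> n"
  shows "C * hits (1 / (3 * real n)) (shortfall k (maker_edges h) Tg) s - 2 ^ lack h * (5/6) ^ (s + N)
    \<le> win_prob (s + N) m h"
  using inv
proof (induction s arbitrary: m h)
  case 0
  show ?case
  proof (cases "shortfall k (maker_edges h) Tg")
    case zero: 0
    have "finite Tg" using Tg finite_subset by blast
    then have "alive h \<inter> Tg = {}"
      using zero by (force simp: shortfall_eq_0_iff needy_def)
    then have "blocked h v \<le> Y" if "v \<in> alive h" for v
      using 0(4)[of v] that by auto
    then show ?thesis
      using exit[of h m] 0 zero by simp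
  next
    case (Suc d)
    have "0 \<le> win_prob N m h" by (rule win_prob_nonneg)
    moreover have "0 \<le> 2 ^ lack h * (5/6 :: real) ^ N" by simp
    ultimately have "- (2 ^ lack h * (5/6) ^ N) \<le> win_prob N m h" by linarith
    then show ?thesis by (simp add: Suc)
  qed
next
  case (Suc s)
  define q where "q = 1 / (3 * real n)"
  have q: "0 \<le> q" "q \<le> 1" using k_less by (auto simp: q_def)
  define d where "d = shortfall k (maker_edges h) Tg"
  have finTg: "finite Tg" using Tg finite_subset by blast
  show ?case
  proof (cases "lack h = 0")
    case True
    have "C * hits q d (Suc s) \<le> 1 * 1"
      using C hits_bounds[OF q] by (intro mult_mono) auto
    moreover have "0 \<le> 2 ^ lack h * (5/6 :: real) ^ (Suc s + N)" by simp
    ultimately show ?thesis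
      unfolding win_prob_finished[OF True] q_def[symmetric] d_def[symmetric] by linarith
  next
    case False
    define r where "r = (5/6 :: real) ^ (s + N)"
    have r: "0 \<le> r" by (simp add: r_def)
    define f where "f = (\<lambda>u::nat. C * hits q d s - 2 ^ lack h * r)"
    define g where "g = (\<lambda>u. C * hits q (if u \<in> Tg then d - 1 else d) s - 2 ^ (lack h - 1) * r)"
    have pow: "(2::real) ^ lack h = 2 * 2 ^ (lack h - 1)"
      using False by (cases "lack h") auto
    have hits_le: "hits q d s \<le> hits q (if u \<in> Tg then d - 1 else d) s" for u
      by (rule hits_antimono[OF q]) simp
    have light: "2 * blocked h u \<le> n" if "u \<in> alive h" for u
      using Suc.prems(5)[OF that] by simp
    note IH = Suc.IH[folded q_def r_def]
    have next_inv: "valid (turn a t {u, x} h)" "lack (turn a t {u, x} h) < D"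
      "attempts (turn a t {u, x} h) + s = T"
      "\<And>v. v \<in> alive (turn a t {u, x} h) - Tg \<Longrightarrow> blocked (turn a t {u, x} h) v + b * s \<le> Y"
      "\<And>v. v \<in> alive (turn a t {u, x} h) \<Longrightarrow> 2 * (blocked (turn a t {u, x} h) v + b * s) \<le> n"
      if ux: "u \<in> alive h" "x \<in> fresh n (maker_edges h) u" for u x
    proof -
      show "valid (turn a t {u, x} h)"
        by (rule valid_turn[OF Suc.prems(1) fresh_pair(1)[OF ux]])
      show "lack (turn a t {u, x} h) < D"
        using shortfall_turn_le[of "{u, x}" h "{..<n}"] Suc.prems(2) by linarith
      show "attempts (turn a t {u, x} h) + s = T"
        using Suc.prems(3) by (simp add: attempts_turn)
      fix v
      have step: "blocked (turn a t {u, x} h) v + b * s \<le> blocked h v + b * Suc s"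
        using blocked_turn[OF Suc.prems(1), of "{u, x}" v] by simp
      show "blocked (turn a t {u, x} h) v + b * s \<le> Y" if "v \<in> alive (turn a t {u, x} h) - Tg"
        using step Suc.prems(4)[of v] that alive_turn[of "{u, x}" h] by fastforce
      show "2 * (blocked (turn a t {u, x} h) v + b * s) \<le> n" if "v \<in> alive (turn a t {u, x} h)"
        using step Suc.prems(5)[of v] that alive_turn[of "{u, x}" h] by fastforce
    qed
    have fail: "f u \<le> win_prob (s + N) u (turn a t {u, x} h)"
      if ux: "u \<in> alive h" "x \<in> fresh n (maker_edges h) u" and B: "{u, x} \<in> breaker_edges h" for u x
      using IH[OF next_inv[OF ux], of u] unfolding lack_turn_fail[OF B] f_def d_def .
    have succ: "g u \<le> win_prob (s + N) u (turn a t {u, x} h)"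
      if ux: "u \<in> alive h" "x \<in> fresh n (maker_edges h) u" and B: "{u, x} \<notin> breaker_edges h" for u x
    proof -
      let ?h = "turn a t {u, x} h"
      note drop = shortfall_turn_success[OF _ fresh_pair(2,3)[OF ux] B]
      have "lack ?h \<le> lack h - 1"
        using drop[of "{..<n}"] ux(1) by (simp add: needy_def)
      then have "2 ^ lack ?h * r \<le> 2 ^ (lack h - 1) * r"
        using r by (intro mult_right_mono power_increasing) auto
      moreover have "shortfall k (maker_edges ?h) Tg \<le> (if u \<in> Tg then d - 1 else d)"
        using drop[OF finTg] ux(1) by (auto simp: needy_def d_def)
      then have "hits q (if u \<in> Tg then d - 1 else d) s \<le> hits q (shortfall k (maker_edges ?h) Tg) s"
        by (rule hits_antimono[OF q])
      then have "C * hits q (if u \<in> Tg then d - 1 else d) s \<le> C * hits q (shortfall k (maker_edges ?h) Tg) s"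
        using C by (intro mult_left_mono) auto
      ultimately have "g u \<le> C * hits q (shortfall k (maker_edges ?h) Tg) s - 2 ^ lack ?h * r"
        by (simp add: g_def)
      then show ?thesis
        using IH[OF next_inv[OF ux], of u] by linarith
    qed
    have order: "f u \<le> g u" if "u \<in> alive h" for u
    proof -
      have "C * hits q d s \<le> C * hits q (if u \<in> Tg then d - 1 else d) s"
        using C hits_le by (intro mult_left_mono) auto
      moreover have "2 ^ (lack h - 1) * r \<le> 2 ^ lack h * r"
        using r by (simp add: pow)
      ultimately show ?thesis by (simp add: f_def g_def)
    qed
    have "avg (alive h) (\<lambda>u. (g u + 2 * f u) / 3) \<le> win_prob (Suc (s + N)) m h"
    proof (rule win_prob_spread_ge[OF spread[OF Suc.prems(1,2)] Suc.prems(1) _ n light])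
      show "lack h > 0" using False by simp
    qed (use fail succ order in auto)
    moreover have "C * hits q d (Suc s) - 2 ^ lack h * (5/6) ^ (Suc s + N)
        \<le> avg (alive h) (\<lambda>u. (g u + 2 * f u) / 3)"
    proof -
      define e where "e = hits q (d - 1) s - hits q d s"
      have e: "0 \<le> e" unfolding e_def using hits_antimono[OF q, of "d - 1" d s] by simp
      have ne: "finite (alive h)" "alive h \<noteq> {}"
        using alive_nonempty[of h] False by (auto simp: finite_needy)
      have "avg (alive h) (\<lambda>u. (g u + 2 * f u) / 3) =
          avg (alive h) (\<lambda>u. (C * hits q d s - (5/6) * 2 ^ lack h * r) + (C * e / 3) * (if u \<in> Tg then 1 else 0))"
        by (intro avg_cong) (auto simp: g_def f_def e_def pow field_simps)
      also have "\<dots> = (C * hits q d s - (5/6) * 2 ^ lack h * r)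
          + (C * e / 3) * (real (card {u \<in> alive h. u \<in> Tg}) / real (card (alive h)))"
        by (simp only: avg_affine[OF ne] avg_indicator[OF ne(1)])
      also have "\<dots> \<ge> (C * hits q d s - (5/6) * 2 ^ lack h * r) + C * q * (if d = 0 then 0 else e)"
      proof (cases "d = 0")
        case True
        then show ?thesis using C e by simp
      next
        case d: False
        then obtain v where v: "v \<in> Tg" "edge_degree (maker_edges h) v < k"
          unfolding d_def using shortfall_eq_0_iff[OF finTg] by (metis not_le)
        then have "v \<in> {u \<in> alive h. u \<in> Tg}" using Tg by (auto simp: needy_def)
        then have "1 \<le> real (card {u \<in> alive h. u \<in> Tg})"
          using ne(1) by (simp add: Suc_le_eq card_gt_0_iff) blast
        moreover have "0 < card (alive h)" using ne by (simp add: card_gt_0_iff)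
        ultimately have "1 / real n \<le> real (card {u \<in> alive h. u \<in> Tg}) / real (card (alive h))"
          using card_alive_le[of h] by (intro frac_le) auto
        then have "(C * e / 3) * (1 / real n) \<le>
            (C * e / 3) * (real (card {u \<in> alive h. u \<in> Tg}) / real (card (alive h)))"
          using C e by (intro mult_left_mono) auto
        then show ?thesis using d by (simp add: q_def mult_ac)
      qed
      finally have "(C * hits q d s - (5/6) * 2 ^ lack h * r) + C * q * (if d = 0 then 0 else e)
        \<le> avg (alive h) (\<lambda>u. (g u + 2 * f u) / 3)" .
      moreover have "hits q d (Suc s) = hits q d s + q * (if d = 0 then 0 else e)"
        by (cases d) (auto simp: e_def algebra_simps)
      ultimately show ?thesis
        by (simp add: r_def algebra_simps)
    qed
    ultimately show ?thesis
      unfolding q_def[symmetric] d_def[symmetric] by simp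
  qed
qed


text \<open>
Windows are so short that PhantomBreaker cannot claim more than \<open>n / 8\<close> edges within one. The targets of a window
are the vertices that already have more than \<open>n / 8\<close> blocked edges at its start; there are at most \<open>D\<close>
of them, whatever PhantomBreaker did. If every window saves its targets, a needy vertex
never has more than \<open>n / 2\<close> blocked edges: once it exceeds \<open>n / 8\<close> it becomes a target when the
next window starts, and is saved before that one ends. Each window succeeds with probability at least \<open>c\<close>.
\<close>

lemma windows:
  assumes spread: "\<And>w m. K w m = spread n k w"
    and n: "4 * k \<le> n"
    and s: "8 * (b * s) \<le> n"
    and c: "0 \<le> c" "c \<le> 1" "\<And>d. d \<le> k * D \<Longrightarrow> c \<le> hits (1 / (3 * real n)) d s"
    and T: "2 * (b * T) \<le> (n div 8) * D" "8 \<le> n"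
    and inv: "valid h" "attempts h + J * s \<le> T"
      "\<And>v. v \<in> alive h \<Longrightarrow> blocked h v \<le> n div 8 + b * s"
  shows "c ^ J - 2 ^ lack h * (5/6) ^ (J * s) \<le> win_prob (J * s) m h"
  using inv
proof (induction J arbitrary: m h)
  case 0
  then show ?case by (simp add: win_prob_0)
next
  case (Suc J)
  define X where "X = n div 8"
  have X: "X > 0" "8 * X \<le> n" using T(2) by (auto simp: X_def)
  define Tg where "Tg = {v. v < n \<and> real (blocked h v) > real X}"
  have "real (card Tg) \<le> 2 * real (card (breaker_edges h)) / real X"
    unfolding Tg_def using few_heavily_blocked[OF Suc.prems(1), of "real X"] X by simp
  also have "\<dots> \<le> real D"
  proof -
    have "card (breaker_edges h) \<le> b * T"
      using card_breaker_le[OF Suc.prems(1)] Suc.prems(2) mult_le_mono2[of "attempts h" T b] by linarith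
    then have "2 * card (breaker_edges h) \<le> X * D" using T(1) unfolding X_def by linarith
    then have "real (2 * card (breaker_edges h)) \<le> real (X * D)" by (simp only: of_nat_le_iff)
    then show ?thesis using X by (simp add: field_simps)
  qed
  finally have card: "card Tg \<le> D" by simp
  have "shortfall k (maker_edges h) Tg \<le> (\<Sum>v\<in>Tg. k)"
    unfolding shortfall_def by (rule sum_mono) simp
  also have "\<dots> \<le> k * D" using card by (simp add: mult.commute)
  finally have d: "shortfall k (maker_edges h) Tg \<le> k * D" .
  have "c ^ J * hits (1 / (3 * real n)) (shortfall k (maker_edges h) Tg) s
      - 2 ^ lack h * (5/6) ^ (s + J * s) \<le> win_prob (s + J * s) m h"
  proof (rule window[where D="Suc (lack h)" and T="attempts h + s" and Y="X + b * s"])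
    show "Tg \<subseteq> {..<n}" by (auto simp: Tg_def)
    show "c ^ J \<le> 1" using c by (intro power_le_one) auto
    fix v
    show "blocked h v + b * s \<le> X + b * s" if "v \<in> alive h - Tg"
      using that by (auto simp: Tg_def needy_def)
    show "2 * (blocked h v + b * s) \<le> n" if "v \<in> alive h"
      using Suc.prems(3)[OF that] s X by (simp add: X_def)
  next
    fix h' m'
    assume h': "valid h'" "attempts h' = attempts h + s"
      "\<And>v. v \<in> alive h' \<Longrightarrow> blocked h' v \<le> X + b * s"
    show "c ^ J - 2 ^ lack h' * (5/6) ^ (J * s) \<le> win_prob (J * s) m' h'"
      by (rule Suc.IH) (use h' Suc.prems(2) X_def in auto)
  qed (use spread n c Suc.prems(1) in auto)
  moreover have "c ^ J * c \<le> c ^ J * hits (1 / (3 * real n)) (shortfall k (maker_edges h) Tg) s"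
    using c d by (intro mult_left_mono) auto
  ultimately show ?case
    by (simp add: mult.commute)
qed

end

lemma power_decay:
  assumes "5 * L \<le> N"
  shows "2 ^ L * (5/6 :: real) ^ N \<le> (9/10) ^ L"
proof -
  have "(5/6 :: real) ^ N \<le> (5/6) ^ (5 * L)"
    using assms by (intro power_decreasing) auto
  then have "2 ^ L * (5/6 :: real) ^ N \<le> 2 ^ L * ((5/6) ^ 5) ^ L"
    by (simp add: power_mult)
  also have "\<dots> = (2 * (5/6) ^ 5) ^ L"
    by (simp only: power_mult_distrib)
  also have "\<dots> \<le> (9/10) ^ L"
    by (intro power_mono) (auto simp: power_numeral_reduce)
  finally show ?thesis .
qed

lemma eventually_power_small:
  assumes "0 < (\<epsilon>::real)"
  shows "\<exists>n0. \<forall>n\<ge>n0. (9/10) ^ n \<le> \<epsilon>"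
proof -
  have "(\<lambda>n. (9/10 :: real) ^ n) \<longlonglongrightarrow> 0"
    by (rule LIMSEQ_power_zero) simp
  then have "\<forall>\<^sub>F n in sequentially. (9/10 :: real) ^ n < \<epsilon>"
    using assms by (simp add: order_tendsto_iff)
  then show ?thesis
    by (auto simp: eventually_sequentially intro: less_imp_le)
qed

lemma nat_div_ge_half:
  assumes "0 < (c::nat)" "c \<le> n"
  shows "n \<le> 2 * c * (n div c)"
proof -
  have "n div c \<ge> 1" using assms by (simp add: div_greater_zero_iff Suc_leI)
  have "n = c * (n div c) + n mod c" by simp
  also have "\<dots> \<le> c * (n div c) + c * (n div c)"
    using assms(1) \<open>n div c \<ge> 1\<close> by (intro add_left_mono order_trans[OF less_imp_le[OF mod_less_divisor]]) auto
  finally show ?thesis by simp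
qed

lemma shortfall_empty: "shortfall k (maker_edges []) {..<n} = k * n"
  by (simp add: shortfall_def maker_edges_def edge_degree_def)

text \<open>
The number \<open>J\<close> of windows is a constant, as each lasts for a linear number of attempts and \<open>5 * k * n\<close>
attempts are enough. So \<open>c ^ J\<close> is a positive constant as well, and the error term for running out of
time is exponentially small.
\<close>

lemma positive_probability:
  assumes "a > 0" "b > 0" "k > 0"
  shows "\<exists>c::real. c > 0 \<and> (\<exists>n0. \<forall>n\<ge>n0.
    \<exists>\<sigma>\<in>randomized_maker_strategies n. \<forall>\<tau>\<in>randomized_breaker_strategies n b.
      c \<le> maker_win_prob (mindegree_family n k) a \<sigma> \<tau>)"
proof -
  \<comment> \<open>the total number of attempts will be at most 10 k n; twice the 10 b k n edges that
    PhantomBreaker can claim meanwhile, divided by n / 16, a lower bound for n div 8, bounds the number of targets\<close>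
  define D where "D = 320 * b * k"
  define M where "M = k * D"
  define J where "J = 80 * k * b"
  define r where "r = 1 / (16 * real b)"
  define c where "c = (r / (3 * real M)) ^ M / 2"
  have MD: "M > 0" "D > 0" using assms by (auto simp: M_def D_def)
  have r: "0 < r" "r \<le> 1" using assms by (auto simp: r_def)
  have c: "0 < c" using MD r by (simp add: c_def)
  have "r / (3 * real M) \<le> 1" using MD r by (simp add: field_simps)
  then have c1: "c \<le> 1"
    using MD r power_le_one[of "r / (3 * real M)" M] by (simp add: c_def)
  obtain n1 where n1: "\<And>n. n \<ge> n1 \<Longrightarrow> (9/10) ^ n \<le> c ^ J / 2"
    using eventually_power_small[of "c ^ J / 2"] c by auto
  define n0 where "n0 = Max {n1, 8, 4 * k + 1, 8 * b, 16 * b * M}"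
  have "\<exists>\<sigma>\<in>randomized_maker_strategies n. \<forall>\<tau>\<in>randomized_breaker_strategies n b.
      c ^ J / 2 \<le> maker_win_prob (mindegree_family n k) a \<sigma> \<tau>" if "n \<ge> n0" for n
  proof (rule randomized_strategy_from_kernel[where K="\<lambda>w m. spread n k w" and m=0])
    have n: "n1 \<le> n" "8 \<le> n" "4 * k + 1 \<le> n" "8 * b \<le> n" "16 * b * M \<le> n"
      using that by (auto simp: n0_def)
    then show "n \<ge> 2" by simp
    show "legal n w e" if "(e, m') \<in> set_pmf (spread n k w)" for w m e m'
      by (rule legal_spread[OF _ _ that]) (use n in auto)
    fix t assume t: "t \<in> breaker_strategies n b"
    interpret mindegree_game n a b k t "\<lambda>w m. spread n k w"
      using assms n t by unfold_locales auto
    define s where "s = n div (8 * b)"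
    have s_ge: "n \<le> 16 * b * s"
      using nat_div_ge_half[of "8 * b" n] assms n by (simp add: s_def)
    have s_le: "8 * (b * s) \<le> n"
      by (simp add: s_def flip: mult.assoc)
    have "win_prob (J * s) 0 [] \<ge> c ^ J - 2 ^ lack [] * (5/6) ^ (J * s)"
    proof (rule windows[where D=D and T="J * s"])
      show "c \<le> hits (1 / (3 * real n)) d s" if "d \<le> k * D" for d
        unfolding c_def
      proof (rule hits_ge_constant)
        have "16 * b * M \<le> 16 * b * s" using n(5) s_ge by linarith
        then show "M \<le> s" using assms(2) by simp
        have "real n \<le> real (16 * b * s)" using s_ge by (simp only: of_nat_le_iff)
        then show "r * real n \<le> real s" using assms(2) by (simp add: r_def field_simps)
        have "s \<le> 8 * (b * s)" using assms(2) by (cases b) auto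
        then show "s \<le> n" using s_le by linarith
      qed (use that n MD r M_def in auto)
      have "2 * (b * (J * s)) = 20 * b * k * (8 * (b * s))"
        by (simp add: J_def)
      also have "\<dots> \<le> 20 * b * k * n"
        using s_le by (rule mult_le_mono2)
      also have "\<dots> \<le> 20 * b * k * (16 * (n div 8))"
        using nat_div_ge_half[of 8 n] n by (intro mult_le_mono2) simp
      also have "\<dots> = (n div 8) * D" by (simp add: D_def)
      finally show "2 * (b * (J * s)) \<le> (n div 8) * D" .
    qed (use c c1 n s_le valid_Nil in \<open>auto simp: breaker_edges_def edge_degree_def\<close>)
    moreover have "2 ^ lack [] * (5/6 :: real) ^ (J * s) \<le> c ^ J / 2"
    proof -
      have "5 * (k * n) \<le> 5 * (k * (16 * b * s))"
        using s_ge by (intro mult_le_mono2)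
      then have "5 * (k * n) \<le> J * s" by (simp add: J_def mult_ac)
      then have "2 ^ lack [] * (5/6 :: real) ^ (J * s) \<le> (9/10) ^ (k * n)"
        using power_decay[of "k * n" "J * s"] by (simp add: shortfall_empty)
      also have "\<dots> \<le> (9/10) ^ n"
        using assms(3) by (intro power_decreasing) auto
      also have "\<dots> \<le> c ^ J / 2" by (rule n1[OF n(1)])
      finally show ?thesis .
    qed
    ultimately show "c ^ J / 2 \<le> measure_pmf.prob (chain a t (\<lambda>w m. spread n k w) (J * s) 0 []) (finished n k)"
      unfolding win_prob_def by linarith
  qed (use assms in auto)
  moreover have "c ^ J / 2 > 0" using c by simp
  ultimately show ?thesis by blast
qed

section \<open>Pairing needy vertices, with repair\<close>

text \<open>
The efficient strategy. While the shortfall is at least \<open>d\<close>, two needy vertices are joined, which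
uses both ends of the edge. PhantomBreaker can spoil this at a vertex \<open>u\<close> by claiming the edges from
\<open>u\<close> to the other needy vertices, of which fewer and fewer remain. Hence, after a failure, \<open>u\<close> is
repaired at once: it is joined to random vertices of the whole board until one attempt succeeds.
The last \<open>d\<close> units of the shortfall are left to spreading.
\<close>

definition partners :: "nat \<Rightarrow> nat \<Rightarrow> edge set \<Rightarrow> nat \<Rightarrow> nat set" where
  "partners n k F u = needy n k F \<inter> fresh n F u"

definition failed :: "view \<Rightarrow> bool" where
  "failed w \<longleftrightarrow> w \<noteq> [] \<and> \<not> snd (hd w)"

definition pairing :: "nat \<Rightarrow> nat \<Rightarrow> nat \<Rightarrow> nat kernel" where
  "pairing n k d w m =
     (if owned w \<subseteq> complete_edges n \<and> d \<le> shortfall k (owned w) {..<n}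
      then if failed w \<and> m \<in> needy n k (owned w)
        then pick {m} (fresh n (owned w))
        else pick (needy n k (owned w)) (partners n k (owned w))
      else spread n k w)"

lemma card_partners:
  assumes "F \<subseteq> complete_edges n" "u \<in> needy n k F"
  shows "card (needy n k F) \<le> card (partners n k F u) + k"
proof -
  have "card {x. {u, x} \<in> F} < k"
    using assms card_neighbours[OF assms(1), of u] by (simp add: needy_def)
  then have "card (insert u {x. {u, x} \<in> F}) \<le> k"
    using card_insert_le_m1[of k "{x. {u, x} \<in> F}" u] by linarith
  moreover have "needy n k F \<subseteq> partners n k F u \<union> insert u {x. {u, x} \<in> F}"
    by (auto simp: partners_def fresh_def needy_def)
  then have "card (needy n k F) \<le> card (partners n k F u \<union> insert u {x. {u, x} \<in> F})"
    using finite_neighbours[OF assms(1)] by (intro card_mono) (auto simp: partners_def finite_fresh)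
  ultimately show ?thesis
    using card_Un_le[of "partners n k F u" "insert u {x. {u, x} \<in> F}"] by linarith
qed

lemma partners_nonempty:
  assumes "F \<subseteq> complete_edges n" "u \<in> needy n k F" "k * k < d" "d \<le> shortfall k F {..<n}"
  shows "finite (partners n k F u) \<and> partners n k F u \<noteq> {}"
proof -
  have "k * k < k * card (needy n k F)"
    using assms(3,4) shortfall_le_needy[of k F n] by linarith
  then have "k < card (needy n k F)" by simp
  then show ?thesis
    using card_partners[OF assms(1,2)] by (auto simp: partners_def finite_fresh)
qed

lemma legal_pairing:
  assumes "k < n" "n \<ge> 2" "k * k < d" "(e, m') \<in> set_pmf (pairing n k d w m)"
  shows "legal n w e"
proof (cases "owned w \<subseteq> complete_edges n \<and> d \<le> shortfall k (owned w) {..<n}")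
  case True
  show ?thesis
  proof (cases "failed w \<and> m \<in> needy n k (owned w)")
    case m: True
    then have "set_pmf (pick {m} (fresh n (owned w))) =
        {({u, x}, u) | u x. u \<in> {m} \<and> x \<in> fresh n (owned w) u}"
      using True fresh_needy_nonempty[OF _ _ assms(1)] by (intro set_pick) auto
    then show ?thesis
      using assms(4) True m legal_fresh by (auto simp: pairing_def needy_def)
  next
    case False
    have "needy n k (owned w) \<noteq> {}"
      using True assms(3) shortfall_le_needy[of k "owned w" n] by auto
    then have "set_pmf (pick (needy n k (owned w)) (partners n k (owned w))) =
        {({u, x}, u) | u x. u \<in> needy n k (owned w) \<and> x \<in> partners n k (owned w) u}"
      using True partners_nonempty[OF _ _ assms(3)] by (intro set_pick) (auto simp: finite_needy)
    then show ?thesis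
      using assms(4) True False legal_fresh by (auto simp: pairing_def needy_def partners_def)
  qed
next
  case False
  then have "pairing n k d w m = spread n k w"
    unfolding pairing_def by (rule if_not_P)
  then show ?thesis
    using legal_spread assms by metis
qed

text \<open>
A picked vertex is any given needy one with probability at least \<open>1 / L\<close>, where \<open>L\<close> is the shortfall,
and the pick lowers \<open>L\<close> by \<open>2\<close>. The exponent makes the shortfall of a target set, weighted by
this power of \<open>L\<close>, a supermartingale.
\<close>

lemma powr_decay:
  fixes L :: real and k :: nat
  assumes "k > 0" "L \<ge> 4"
  shows "(L - 2) powr (- 1 / (4 * real k)) * (1 - 1 / (real k * L)) \<le> L powr (- 1 / (4 * real k))"
proof -
  define \<alpha> where "\<alpha> = 1 / (4 * real k)"
  define y where "y = 2 / L"
  have y: "0 \<le> y" "y \<le> 1 / 2" using assms by (auto simp: y_def field_simps)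
  have "2 * (y * y) \<le> y" using y mult_right_mono[of y "1/2" y] by simp
  then have ln: "- (2 * y) \<le> ln (1 - y)"
    using ln_one_minus_pos_lower_bound[OF y] by (simp add: power2_eq_square)
  have "1 - 1 / (real k * L) \<le> exp (- 1 / (real k * L))"
    using exp_ge_add_one_self[of "- 1 / (real k * L)"] by simp
  also have "- 1 / (real k * L) = \<alpha> * (- (2 * y))"
    using assms by (simp add: \<alpha>_def y_def)
  also have "exp (\<alpha> * (- (2 * y))) \<le> exp (\<alpha> * ln (1 - y))"
    using mult_left_mono[OF ln, of \<alpha>] by (simp only: exp_le_cancel_iff) (simp add: \<alpha>_def)
  also have "\<dots> = (1 - y) powr \<alpha>"
    using y by (simp add: powr_def)
  finally have "(L - 2) powr (- \<alpha>) * (1 - 1 / (real k * L)) \<le> (L - 2) powr (- \<alpha>) * (1 - y) powr \<alpha>"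
    by (intro mult_left_mono) auto
  also have "(L - 2) powr (- \<alpha>) * (1 - y) powr \<alpha> = L powr (- \<alpha>)"
  proof -
    have "L - 2 = L * (1 - y)"
      using assms by (simp add: y_def field_simps)
    then show ?thesis
      using assms y by (simp add: powr_mult powr_minus)
  qed
  finally show ?thesis by (simp add: \<alpha>_def)
qed

text \<open>
The bias enters through \<open>b * k \<le> 2 * a\<close> alone. The lower bounds on \<open>d\<close> hold for large \<open>n\<close> when \<open>d\<close> is a
fixed fraction of \<open>n\<close>.
\<close>

locale pairing_game = mindegree_game n a b k t "pairing n k d"
  for n a b k t and d :: nat +
  assumes bias: "b * k \<le> 2 * a"
    and d_large: "4 \<le> d" "4 * (k * k) \<le> d" "8 * (n * (k * k)) \<le> d * d"
    and n_large: "4 * k \<le> n" "d \<le> n"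
begin

definition repairing :: "history \<Rightarrow> bool" where
  "repairing h \<longleftrightarrow> failed (maker_view h)"

text \<open>
Every attempt could lower the shortfall by \<open>2\<close>; the waste is the deficit against this ideal. A failure
costs \<open>2\<close>, a repairing success \<open>1\<close> or \<open>0\<close>, a successful pairing nothing.
\<close>

definition waste :: "history \<Rightarrow> real" where
  "waste h = 2 * real (attempts h) - (real k * real n - real (lack h))"

text \<open>
A lower bound on the success probability of a repairing attempt.
\<close>

definition \<rho> :: real where
  "\<rho> = real d / (4 * real k * real n)"

text \<open>
An upper bound on the failure probability of a pairing attempt.
\<close>

definition \<mu> :: real where
  "\<mu> = 4 * real n * real k ^ 2 / real d ^ 2"

text \<open>
The waste so far plus a bound on the expected waste to come: a repair lasts for \<open>1 / \<rho>\<close> attempts on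
average and wastes at most \<open>2\<close> in each, and the last term pays for the failures that future
pairings cause with probability at most \<open>\<mu>\<close> each.
\<close>

definition cost :: "history \<Rightarrow> real" where
  "cost h = waste h + (if repairing h then 2 / \<rho> else 0) + 4 * \<mu> / \<rho> * real (lack h)"

text \<open>
A vertex under repair is served until it gets its edge, so that unit is counted as gained when the
vertex is picked, not when the repair ends. The quantities \<open>target\<close> and \<open>rest\<close> thus change at every pick,
whether it succeeds or fails, and a repair can only lower the weighted target.
\<close>

definition target :: "nat set \<Rightarrow> nat \<Rightarrow> history \<Rightarrow> real" where
  "target Tg m h = real (shortfall k (maker_edges h) Tg) - (if repairing h \<and> m \<in> Tg then 1 else 0)"

definition rest :: "history \<Rightarrow> real" where
  "rest h = real (lack h) - (if repairing h then 2 else 0)"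

text \<open>
A lower bound for the winning probability: the value \<open>E\<close> of the next phase, minus the weighted
shortfall of the targets, minus the cost. By Markov's inequality the cost term accounts for the
event that the waste reaches \<open>d / 2\<close>, in which PhantomBreaker would get too many edges.
\<close>

definition score :: "real \<Rightarrow> real \<Rightarrow> nat set \<Rightarrow> nat \<Rightarrow> history \<Rightarrow> real" where
  "score E \<theta> Tg m h =
     E - \<theta> * target Tg m h * rest h powr (- 1 / (4 * real k)) - cost h / (real d / 2)"

text \<open>
The bound on the blocked edges of needy vertices outside \<open>Tg\<close> only uses that an attempt is followed by
at most \<open>b\<close> claims, which is precise enough for a late phase of few attempts. The slack \<open>2\<close> in \<open>D \<le> lack h + 2\<close>
keeps the predicate true at the moment when the shortfall drops below \<open>D\<close>.
\<close>

definition state :: "nat \<Rightarrow> real \<Rightarrow> nat set \<Rightarrow> nat \<Rightarrow> nat \<Rightarrow> nat \<Rightarrow> history \<Rightarrow> bool" where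
  "state D Y Tg T N m h \<longleftrightarrow> valid h \<and> D \<le> lack h + 2 \<and> (repairing h \<longrightarrow> m \<in> alive h \<and> d \<le> lack h)
     \<and> k * n \<le> lack h + 2 * attempts h \<and> attempts h + N = T
     \<and> (\<forall>v \<in> alive h - Tg. real (blocked h v) \<le> Y + real b * real (attempts h))"

lemma repairing_turn: "repairing (turn a t e h) \<longleftrightarrow> e \<in> breaker_edges h"
  by (simp add: repairing_def failed_def maker_view_turn)

lemma lack_turn_ge:
  assumes "u \<in> alive h" "x \<in> fresh n (maker_edges h) u"
  shows "lack h \<le> lack (turn a t {u, x} h) + 2"
proof (cases "{u, x} \<in> breaker_edges h")
  case True
  then show ?thesis by (simp add: lack_turn_fail)
next
  case False
  then show ?thesis
    using shortfall_turn_success[OF _ fresh_pair(2,3)[OF assms] False, of "{..<n}"] by simp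
qed

lemma state_turn:
  assumes st: "state D Y Tg T (Suc N) m h" and "D \<le> lack h" "d \<le> lack h"
    and u: "u \<in> alive h" and x: "x \<in> fresh n (maker_edges h) u"
  shows "state D Y Tg T N u (turn a t {u, x} h)"
proof -
  let ?h = "turn a t {u, x} h"
  have valid: "valid h" using st by (simp add: state_def)
  have "real (blocked ?h v) \<le> Y + real b * real (attempts ?h)" if "v \<in> alive ?h - Tg" for v
  proof -
    have "real (blocked ?h v) \<le> real (blocked h v) + real b"
      using blocked_turn[OF valid, of "{u, x}" v] by linarith
    moreover have "real (blocked h v) \<le> Y + real b * real (attempts h)"
      using that alive_turn[of "{u, x}" h] st by (auto simp: state_def)
    ultimately show ?thesis by (simp add: attempts_turn algebra_simps)
  qed
  moreover have "valid ?h"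
    by (rule valid_turn[OF valid fresh_pair(1)[OF u x]])
  moreover have "lack h \<le> lack ?h + 2"
    by (rule lack_turn_ge[OF u x])
  moreover have "u \<in> alive ?h \<and> d \<le> lack ?h" if "repairing ?h"
  proof -
    have B: "{u, x} \<in> breaker_edges h" using that by (simp add: repairing_turn)
    then show ?thesis using u assms(3) by (simp add: lack_turn_fail maker_edges_turn)
  qed
  ultimately show ?thesis
    using st assms(2) by (simp add: state_def attempts_turn)
qed

lemma d_pos: "d > 0" using d_large by simp

lemma n_pos: "n > 0" using k_less by simp

lemma \<rho>_bounds: "0 < \<rho>" "\<rho> \<le> 1"
proof -
  show "0 < \<rho>" using d_pos n_pos k_pos by (simp add: \<rho>_def)
  have "1 * real d \<le> 4 * real k * real n" using n_large k_pos by (intro mult_mono) auto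
  then show "\<rho> \<le> 1" using n_pos k_pos by (simp add: \<rho>_def)
qed

lemma \<mu>_bounds: "0 \<le> \<mu>" "\<mu> \<le> 1 / 2"
proof -
  show "0 \<le> \<mu>" by (simp add: \<mu>_def)
  have "real (8 * (n * (k * k))) \<le> real (d * d)" using d_large(3) by (simp only: of_nat_le_iff)
  then show "\<mu> \<le> 1 / 2"
    using d_pos by (simp add: \<mu>_def power2_eq_square field_simps)
qed

lemma state_nonneg:
  assumes "state D Y Tg T N m h" "finite Tg"
  shows "0 \<le> waste h" "0 \<le> cost h" "0 \<le> target Tg m h"
proof -
  have "real (k * n) \<le> real (lack h + 2 * attempts h)"
    using assms by (simp only: state_def of_nat_le_iff)
  then show w: "0 \<le> waste h" by (simp add: waste_def)
  show "0 \<le> cost h"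
    using w \<rho>_bounds \<mu>_bounds by (simp add: cost_def)
  show "0 \<le> target Tg m h"
  proof (cases "repairing h \<and> m \<in> Tg")
    case True
    then have "m \<in> alive h" using assms(1) by (simp add: state_def)
    then have "shortfall k (maker_edges h) Tg \<noteq> 0"
      using True shortfall_eq_0_iff[OF assms(2), of k "maker_edges h"] by (auto simp: needy_def)
    then show ?thesis by (simp add: target_def)
  qed (auto simp: target_def)
qed

lemma score_le:
  assumes "state D Y Tg T N m h" "finite Tg" "0 \<le> \<theta>"
  shows "score E \<theta> Tg m h \<le> E - cost h / (real d / 2)"
proof -
  have "0 \<le> \<theta> * target Tg m h * rest h powr (- 1 / (4 * real k))"
    using state_nonneg[OF assms(1,2)] assms(3) by (intro mult_nonneg_nonneg) auto
  then show ?thesis unfolding score_def by linarith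
qed

lemma waste_small:
  assumes "state D Y Tg T N m h" "finite Tg" "0 \<le> \<theta>" "E \<le> 1" "0 < score E \<theta> Tg m h"
  shows "waste h < real d / 2"
proof -
  have "cost h / (real d / 2) < 1"
    using score_le[OF assms(1-3), of E] assms(4,5) by linarith
  then have "cost h < real d / 2" using d_pos by (simp add: field_simps)
  moreover have "waste h \<le> cost h"
    using \<rho>_bounds \<mu>_bounds by (simp add: cost_def)
  ultimately show ?thesis by simp
qed

text \<open>
Here the bias is used. An attempt without waste lowers the shortfall by \<open>2\<close> and gives PhantomBreaker
\<open>b / a \<le> 2 / k\<close> edges on average, so without waste he owns at most \<open>n - lack h / k\<close> edges. As long
as the waste stays well below the remaining shortfall, he cannot have isolated any vertex.
\<close>

lemma card_breaker_waste:
  assumes "valid h"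
  shows "real k * real (card (breaker_edges h)) \<le> real k * real n - real (lack h) + waste h"
proof -
  have "k * card (breaker_edges h) \<le> k * (b * (attempts h div a))"
    using assms by (simp add: valid_def)
  also have "\<dots> = (b * k) * (attempts h div a)" by simp
  also have "\<dots> \<le> (2 * a) * (attempts h div a)" by (rule mult_le_mono1[OF bias])
  also have "\<dots> \<le> 2 * attempts h" by simp
  finally have "real (k * card (breaker_edges h)) \<le> real (2 * attempts h)" by (simp only: of_nat_le_iff)
  then show ?thesis by (simp add: waste_def)
qed

lemma card_breaker_le_n:
  assumes "valid h" "waste h \<le> real (lack h)"
  shows "real (card (breaker_edges h)) \<le> real n"
proof -
  have "real k * real (card (breaker_edges h)) \<le> real k * real n"
    using card_breaker_waste[OF assms(1)] assms(2) by linarith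
  then show ?thesis using k_pos by simp
qed

text \<open>
PhantomBreaker has at most \<open>n - d / (2 * k)\<close> edges altogether, so about \<open>d / (2 * k)\<close> good partners
remain even for a vertex on which he spent all of them.
\<close>

lemma repair_blocking:
  assumes "valid h" "m \<in> alive h" "d \<le> lack h" "waste h < real d / 2"
  shows "blocking h m (fresh n (maker_edges h) m) \<le> 1 - \<rho>"
proof -
  let ?c = "real (card (fresh n (maker_edges h) m))"
  have c: "real n - real k \<le> ?c" using fresh_alive(3)[OF assms(1,2)] by linarith
  have cpos: "?c > 0" using c k_less by linarith
  have "card (fresh n (maker_edges h) m) \<le> card {..<n}"
    by (rule card_mono) (auto simp: fresh_def)
  then have cn: "?c \<le> real n" by simp
  have "real k * real (card (breaker_edges h)) \<le> real k * real n - real d / 2"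
    using card_breaker_waste[OF assms(1)] assms(3,4) by linarith
  then have "real (card (breaker_edges h)) \<le> real n - real d / (2 * real k)"
    using k_pos by (simp add: field_simps)
  moreover have "real (blocked h m) \<le> real (card (breaker_edges h))"
    using edge_degree_le_card[OF valid_finite[OF assms(1)]] by simp
  moreover have "real d / (2 * real k) \<ge> real k + real d / (4 * real k)"
  proof -
    have "real (4 * (k * k)) \<le> real d" using d_large(2) by (simp only: of_nat_le_iff)
    then show ?thesis using k_pos by (simp add: field_simps)
  qed
  moreover have "\<rho> * ?c \<le> \<rho> * real n" using cn \<rho>_bounds by (intro mult_left_mono) auto
  moreover have "\<rho> * real n = real d / (4 * real k)" using n_pos by (simp add: \<rho>_def)
  ultimately have "real (blocked h m) \<le> (1 - \<rho>) * ?c"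
    using c by (simp add: algebra_simps)
  then have "real (blocked h m) / ?c \<le> 1 - \<rho>"
    using cpos by (simp add: field_simps)
  then show ?thesis using blocking_le[OF assms(1), of m "fresh n (maker_edges h) m"] by linarith
qed

text \<open>
Both ends of the edge are random among at least \<open>d / k\<close> needy vertices, and PhantomBreaker owns at most
\<open>n\<close> edges, so an attempt fails with probability of order \<open>1 / n\<close> even though he may choose his edges
with full knowledge.
\<close>

lemma pairing_blocking:
  assumes "valid h" "d \<le> lack h" "waste h < real d / 2"
  shows "avg (alive h) (\<lambda>u. blocking h u (partners n k (maker_edges h) u)) \<le> \<mu>"
proof -
  let ?A = "alive h"
  define m where "m = real (card ?A)"
  have M: "maker_edges h \<subseteq> complete_edges n" and B: "breaker_edges h \<subseteq> complete_edges n"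
    using assms(1) by (auto simp: valid_def)
  have "d \<le> k * card ?A" using assms(2) shortfall_le_needy[of k "maker_edges h" n] by linarith
  then have "real d \<le> real (k * card ?A)" by (simp only: of_nat_le_iff)
  then have dm: "real d \<le> real k * m" by (simp add: m_def)
  have "4 * (k * k) \<le> k * card ?A" using d_large(2) \<open>d \<le> k * card ?A\<close> by linarith
  then have "4 * k \<le> card ?A" using k_pos by simp
  then have m4: "4 * real k \<le> m" unfolding m_def by linarith
  have mpos: "m > 0" using m4 k_pos by simp
  have "blocking h u (partners n k (maker_edges h) u) \<le> 0 + (2 / m) * real (blocked h u)" if u: "u \<in> ?A" for u
  proof -
    have "m - real k \<le> real (card (partners n k (maker_edges h) u))"
      using card_partners[OF M u] unfolding m_def by linarith
    then have "m / 2 \<le> real (card (partners n k (maker_edges h) u))" using m4 by linarith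
    then have "real (blocked h u) / real (card (partners n k (maker_edges h) u)) \<le> real (blocked h u) / (m / 2)"
      using mpos by (intro divide_left_mono) auto
    also have "real (blocked h u) / (m / 2) = 0 + (2 / m) * real (blocked h u)" by simp
    finally show ?thesis
      using blocking_le[OF assms(1), of u "partners n k (maker_edges h) u"] by linarith
  qed
  then have "avg ?A (\<lambda>u. blocking h u (partners n k (maker_edges h) u))
      \<le> avg ?A (\<lambda>u. 0 + (2 / m) * real (blocked h u))"
    by (rule avg_mono)
  also have "\<dots> = 0 + (2 / m) * avg ?A (\<lambda>u. real (blocked h u))"
    using mpos by (intro avg_affine) (auto simp: finite_needy m_def)
  also have "\<dots> \<le> 0 + (2 / m) * (2 * real n / m)"
  proof -
    have "(\<Sum>u\<in>?A. blocked h u) \<le> (\<Sum>v<n. blocked h v)"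
      by (rule sum_mono2) (auto simp: needy_def)
    also have "\<dots> = 2 * card (breaker_edges h)" by (rule sum_edge_degree[OF B])
    finally have "real (\<Sum>u\<in>?A. blocked h u) \<le> 2 * real (card (breaker_edges h))" by linarith
    also have "\<dots> \<le> 2 * real n"
      using card_breaker_le_n[OF assms(1)] assms(2,3) by simp
    finally have "avg ?A (\<lambda>u. real (blocked h u)) \<le> 2 * real n / m"
      using mpos by (simp add: avg_def m_def divide_right_mono)
    then show ?thesis using mpos by (intro add_left_mono mult_left_mono) auto
  qed
  also have "\<dots> = 4 * real n / m ^ 2" by (simp add: power2_eq_square)
  also have "\<dots> \<le> 4 * real n / (real d / real k) ^ 2"
  proof (rule divide_left_mono)
    have "real d / real k \<le> m" using dm k_pos by (simp add: field_simps)
    then show "(real d / real k) ^ 2 \<le> m ^ 2" by (intro power_mono) auto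
    show "0 < m\<^sup>2 * (real d / real k)\<^sup>2" using mpos d_pos k_pos by simp
  qed auto
  also have "\<dots> = \<mu>" by (simp add: \<mu>_def power_divide)
  finally show ?thesis .
qed


lemma waste_turn:
  "waste (turn a t e h) = waste h + 2 - (real (lack h) - real (lack (turn a t e h)))"
  by (simp add: waste_def attempts_turn)

lemma cost_turn_fail:
  assumes "{u, x} \<in> breaker_edges h"
  shows "cost (turn a t {u, x} h) = waste h + 2 + 2 / \<rho> + 4 * \<mu> / \<rho> * real (lack h)"
  by (simp add: cost_def waste_turn repairing_turn assms lack_turn_fail)

lemma weight_le:
  assumes "0 \<le> (\<theta>::real)" "0 \<le> x" "x \<le> x'" "0 < y'" "y' \<le> y"
  shows "\<theta> * x * y powr (- 1 / (4 * real k)) \<le> \<theta> * x' * y' powr (- 1 / (4 * real k))"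
proof -
  have "y powr (- 1 / (4 * real k)) \<le> y' powr (- 1 / (4 * real k))"
    using assms by (intro powr_mono2') auto
  then show ?thesis
    using assms by (intro mult_mono) auto
qed

text \<open>
A failure costs \<open>2\<close>. A success releases the reserve \<open>2 / \<rho>\<close> at a cost of at most \<open>2\<close>. With success
probability at least \<open>\<rho>\<close> the expected cost does not grow, and the target term does not grow in either
case.
\<close>

lemma repair_step:
  assumes st: "state D Y Tg T (Suc N) m h" and D: "d \<le> D" "D \<le> lack h"
    and Tg: "Tg \<subseteq> {..<n}" and \<theta>: "0 \<le> \<theta>" and E: "E \<le> 1"
    and pos: "0 < score E \<theta> Tg m h"
    and rep: "repairing h"
    and IH: "\<And>u h'. state D Y Tg T N u h' \<Longrightarrow> score E \<theta> Tg u h' \<le> win_prob N u h'"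
  shows "score E \<theta> Tg m h \<le> win_prob (Suc N) m h"
proof -
  let ?P = "fresh n (maker_edges h)"
  let ?v = "score E \<theta> Tg m h" and ?g = "real d / 2"
  have finTg: "finite Tg" using Tg finite_subset by blast
  have valid: "valid h" and m: "m \<in> alive h" using st rep by (auto simp: state_def)
  have dl: "d \<le> lack h" using D by simp
  have small: "waste h < real d / 2" by (rule waste_small[OF st finTg \<theta> E pos])
  have K: "pairing n k d (maker_view h) m = pick {m} ?P"
    using valid dl rep m by (simp add: pairing_def owned_view valid_def repairing_def)
  have fail: "?v - 2 / ?g \<le> win_prob N m (turn a t {m, x} h)"
    if x: "x \<in> ?P m" and B: "{m, x} \<in> breaker_edges h" for x
  proof -
    have "cost (turn a t {m, x} h) = cost h + 2"
      by (simp add: cost_turn_fail[OF B]) (simp add: cost_def rep)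
    moreover have "target Tg m (turn a t {m, x} h) = target Tg m h" "rest (turn a t {m, x} h) = rest h"
      by (simp_all add: target_def rest_def repairing_turn rep B lack_turn_fail[OF B])
    ultimately have "score E \<theta> Tg m (turn a t {m, x} h) = ?v - 2 / ?g"
      by (simp only: score_def add_divide_distrib)
    then show ?thesis using IH[OF state_turn[OF st D(2) dl m x]] by simp
  qed
  have succ: "?v + (2 / \<rho> - 2) / ?g \<le> win_prob N m (turn a t {m, x} h)"
    if x: "x \<in> ?P m" and B: "{m, x} \<notin> breaker_edges h" for x
  proof -
    let ?h = "turn a t {m, x} h"
    note st' = state_turn[OF st D(2) dl m x]
    have nr: "\<not> repairing ?h" using B by (simp add: repairing_turn)
    have "lack ?h \<le> lack h" by (rule shortfall_turn_le)
    then have "4 * \<mu> / \<rho> * real (lack ?h) \<le> 4 * \<mu> / \<rho> * real (lack h)"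
      using \<mu>_bounds \<rho>_bounds by (intro mult_left_mono) auto
    then have "cost ?h \<le> cost h - (2 / \<rho> - 2)"
      using \<open>lack ?h \<le> lack h\<close> by (simp add: cost_def rep nr waste_turn)
    then have "cost ?h / ?g \<le> cost h / ?g - (2 / \<rho> - 2) / ?g"
      using d_pos by (simp add: divide_right_mono flip: diff_divide_distrib)
    moreover have "\<theta> * target Tg m ?h * rest ?h powr (- 1 / (4 * real k))
        \<le> \<theta> * target Tg m h * rest h powr (- 1 / (4 * real k))"
    proof (rule weight_le[OF \<theta> state_nonneg(3)[OF st' finTg]])
      show "target Tg m ?h \<le> target Tg m h"
        using shortfall_turn_success[OF finTg fresh_pair(2,3)[OF m x] B] m nr rep
        by (auto simp: target_def needy_def)
      show "0 < rest h" using rep dl d_large(1) by (simp add: rest_def)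
      show "rest h \<le> rest ?h"
        using lack_turn_ge[OF m x] by (simp add: rest_def rep nr)
    qed
    ultimately have "?v + (2 / \<rho> - 2) / ?g \<le> score E \<theta> Tg m ?h"
      unfolding score_def by argo
    then show ?thesis using IH[OF st'] by simp
  qed
  have "?v + (2 / \<rho> - 2) / ?g + ((?v - 2 / ?g) - (?v + (2 / \<rho> - 2) / ?g)) * blocking h m (?P m)
      = avg (?P m) (\<lambda>x. if {m, x} \<in> breaker_edges h then ?v - 2 / ?g else ?v + (2 / \<rho> - 2) / ?g)"
    using fresh_alive[OF valid m] by (intro avg_outcome[symmetric]) auto
  also have "\<dots> \<le> avg (?P m) (\<lambda>x. win_prob N m (turn a t {m, x} h))"
    by (rule avg_mono) (use fail succ in auto)
  also have "\<dots> = win_prob (Suc N) m h"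
    using win_prob_pick[OF K] fresh_alive[OF valid m] by (simp add: avg_def)
  finally have avg: "?v + (2 / \<rho> - 2) / ?g
      + ((?v - 2 / ?g) - (?v + (2 / \<rho> - 2) / ?g)) * blocking h m (?P m) \<le> win_prob (Suc N) m h" .
  have "(v - 2 / g) - (v + (r - 2) / g) = - (r / g)" for v g r :: real
    by (simp add: diff_divide_distrib)
  note this[of ?v ?g "2 / \<rho>"]
  then have "?v + (2 / \<rho> - 2) / ?g - (2 / \<rho> / ?g) * blocking h m (?P m) \<le> win_prob (Suc N) m h"
    using avg by (simp only: mult_minus_left add_uminus_conv_diff)
  moreover have "(2 / \<rho> / ?g) * blocking h m (?P m) \<le> (2 / \<rho> / ?g) * (1 - \<rho>)"
    using repair_blocking[OF valid m dl small] \<rho>_bounds by (intro mult_left_mono) auto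
  moreover have "(2 / \<rho> / ?g) * (1 - \<rho>) = (2 / \<rho> - 2) / ?g"
    using \<rho>_bounds d_pos by (simp add: field_simps)
  ultimately show ?thesis by linarith
qed

text \<open>
The targets have shortfall at most \<open>k\<close> each, so the picked vertex is one of them with probability at
least their shortfall divided by \<open>k * lack h\<close>, which is what \<open>powr_decay\<close> needs.
\<close>

lemma target_progress:
  assumes "Tg \<subseteq> {..<n}" "4 \<le> lack h" "0 \<le> \<theta>"
  shows "\<theta> * (real (shortfall k (maker_edges h) Tg)
      - real (card {u \<in> alive h. u \<in> Tg}) / real (card (alive h)))
      * (real (lack h) - 2) powr (- 1 / (4 * real k))
    \<le> \<theta> * real (shortfall k (maker_edges h) Tg) * real (lack h) powr (- 1 / (4 * real k))"
proof -
  let ?S = "real (shortfall k (maker_edges h) Tg)"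
  let ?c = "real (card {u \<in> alive h. u \<in> Tg})"
  have finTg: "finite Tg" using assms(1) finite_subset by blast
  have "shortfall k (maker_edges h) Tg = shortfall k (maker_edges h) {u \<in> alive h. u \<in> Tg}"
    unfolding shortfall_def using assms(1)
    by (intro sum.mono_neutral_right finTg) (auto simp: needy_def)
  also have "\<dots> \<le> (\<Sum>v\<in>{u \<in> alive h. u \<in> Tg}. k)"
    unfolding shortfall_def by (rule sum_mono) simp
  finally have "shortfall k (maker_edges h) Tg \<le> k * card {u \<in> alive h. u \<in> Tg}"
    by (simp add: mult.commute)
  then have "?S \<le> real (k * card {u \<in> alive h. u \<in> Tg})" by (simp only: of_nat_le_iff)
  then have c: "?S / real k \<le> ?c" using k_pos by (simp add: field_simps)
  have "0 < card (alive h)"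
    using alive_nonempty[of h] assms(2) by (simp add: card_gt_0_iff finite_needy)
  then have "?S / real k / real (lack h) \<le> ?c / real (card (alive h))"
    using c card_needy_le_shortfall[of n k "maker_edges h"] by (intro frac_le) auto
  then have "?S - ?c / real (card (alive h)) \<le> ?S * (1 - 1 / (real k * real (lack h)))"
    by (simp add: algebra_simps)
  then have "(?S - ?c / real (card (alive h))) * (real (lack h) - 2) powr (- 1 / (4 * real k))
      \<le> ?S * (1 - 1 / (real k * real (lack h))) * (real (lack h) - 2) powr (- 1 / (4 * real k))"
    by (rule mult_right_mono) simp
  also have "\<dots> = ?S * ((real (lack h) - 2) powr (- 1 / (4 * real k)) * (1 - 1 / (real k * real (lack h))))"
    by simp
  also have "\<dots> \<le> ?S * real (lack h) powr (- 1 / (4 * real k))"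
    using powr_decay[of k "real (lack h)"] k_pos assms(2) by (intro mult_left_mono) auto
  finally show ?thesis
    using mult_left_mono[OF _ assms(3)] by (simp add: mult.assoc)
qed

text \<open>
For a fixed \<open>u\<close> the target term changes in the same way whether the attempt succeeds or fails; only the
cost distinguishes the two outcomes. So the average over \<open>x\<close> concerns only the cost, and the average
over \<open>u\<close> only the targets.
\<close>

lemma pairing_step:
  assumes st: "state D Y Tg T (Suc N) m h" and D: "d \<le> D" "D \<le> lack h"
    and Tg: "Tg \<subseteq> {..<n}" and \<theta>: "0 \<le> \<theta>" and E: "E \<le> 1"
    and pos: "0 < score E \<theta> Tg m h"
    and nrep: "\<not> repairing h"
    and IH: "\<And>u h'. state D Y Tg T N u h' \<Longrightarrow> score E \<theta> Tg u h' \<le> win_prob N u h'"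
  shows "score E \<theta> Tg m h \<le> win_prob (Suc N) m h"
proof -
  let ?A = "alive h" and ?P = "partners n k (maker_edges h)" and ?g = "real d / 2"
  let ?S = "real (shortfall k (maker_edges h) Tg)"
  let ?c = "real (card {u \<in> alive h. u \<in> Tg}) / real (card (alive h))"
  define w where "w = (real (lack h) - 2) powr (- 1 / (4 * real k))"
  define \<kappa> where "\<kappa> = 4 * \<mu> / \<rho>"
  have \<kappa>: "0 \<le> \<kappa>" using \<mu>_bounds \<rho>_bounds by (simp add: \<kappa>_def)
  have finTg: "finite Tg" using Tg finite_subset by blast
  have valid: "valid h" and M: "maker_edges h \<subseteq> complete_edges n"
    using st by (auto simp: state_def valid_def)
  have dl: "d \<le> lack h" using D by simp
  have l4: "4 \<le> lack h" using dl d_large(1) by simp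
  have small: "waste h < real d / 2" by (rule waste_small[OF st finTg \<theta> E pos])
  have K: "pairing n k d (maker_view h) m = pick ?A ?P"
    using valid dl nrep by (simp add: pairing_def owned_view valid_def repairing_def)
  have ne: "finite ?A" "?A \<noteq> {}"
    using alive_nonempty[of h] l4 by (auto simp: finite_needy)
  have "k * k > 0" using k_pos by simp
  then have "k * k < d" using d_large(2) by linarith
  then have P: "finite (?P u) \<and> ?P u \<noteq> {}" if "u \<in> ?A" for u
    using partners_nonempty[OF M that _ dl] by simp
  have sub: "x \<in> fresh n (maker_edges h) u" "x \<in> ?A" if "x \<in> ?P u" for u x
    using that by (auto simp: partners_def)
  have cost: "cost h = waste h + \<kappa> * real (lack h)"
    by (simp add: cost_def nrep \<kappa>_def)
  define base where "base = (\<lambda>u. E - \<theta> * (?S - (if u \<in> Tg then 1 else 0)) * w - cost h / ?g)"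
  have fail: "base u - (2 + 2 / \<rho>) / ?g \<le> win_prob N u (turn a t {u, x} h)"
    if u: "u \<in> ?A" and x: "x \<in> ?P u" and B: "{u, x} \<in> breaker_edges h" for u x
  proof -
    have "cost (turn a t {u, x} h) = cost h + (2 + 2 / \<rho>)"
      by (simp add: cost_turn_fail[OF B] cost \<kappa>_def)
    moreover have "target Tg u (turn a t {u, x} h) = ?S - (if u \<in> Tg then 1 else 0)"
      "rest (turn a t {u, x} h) = real (lack h) - 2"
      by (simp_all add: target_def rest_def repairing_turn B lack_turn_fail[OF B])
    ultimately have "score E \<theta> Tg u (turn a t {u, x} h) = base u - (2 + 2 / \<rho>) / ?g"
      by (simp only: score_def base_def w_def add_divide_distrib)
    then show ?thesis using IH[OF state_turn[OF st D(2) dl u sub(1)[OF x]]] by simp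
  qed
  have succ: "base u + 2 * \<kappa> / ?g \<le> win_prob N u (turn a t {u, x} h)"
    if u: "u \<in> ?A" and x: "x \<in> ?P u" and B: "{u, x} \<notin> breaker_edges h" for u x
  proof -
    let ?h = "turn a t {u, x} h"
    note st' = state_turn[OF st D(2) dl u sub(1)[OF x]]
    note drop = shortfall_turn_success[OF _ fresh_pair(2,3)[OF u sub(1)[OF x]] B]
    have nr: "\<not> repairing ?h" using B by (simp add: repairing_turn)
    have lack: "lack h = lack ?h + 2"
      using drop[of "{..<n}"] u sub(2)[OF x] by (simp add: needy_def)
    then have rl: "real (lack ?h) = real (lack h) - 2" by simp
    have "cost ?h = cost h - 2 * \<kappa>"
    proof -
      have "cost ?h = waste h + \<kappa> * (real (lack h) - 2)"
        by (simp add: cost_def[of ?h] nr waste_turn rl flip: \<kappa>_def)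
      then show ?thesis by (simp add: cost algebra_simps)
    qed
    moreover have "\<theta> * target Tg u ?h * rest ?h powr (- 1 / (4 * real k))
        \<le> \<theta> * (?S - (if u \<in> Tg then 1 else 0)) * (real (lack h) - 2) powr (- 1 / (4 * real k))"
    proof (rule weight_le[OF \<theta> state_nonneg(3)[OF st' finTg]])
      show "target Tg u ?h \<le> ?S - (if u \<in> Tg then 1 else 0)"
        using drop[OF finTg] u by (auto simp: target_def nr needy_def)
      show "0 < real (lack h) - 2" using l4 by simp
      show "real (lack h) - 2 \<le> rest ?h" by (simp add: rest_def nr rl)
    qed
    ultimately have "base u + 2 * \<kappa> / ?g \<le> score E \<theta> Tg u ?h"
      unfolding score_def base_def w_def by (simp add: diff_divide_distrib)
    then show ?thesis using IH[OF st'] by simp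
  qed
  have "base u + 2 * \<kappa> / ?g - ((2 + 2 / \<rho> + 2 * \<kappa>) / ?g) * blocking h u (?P u)
      \<le> avg (?P u) (\<lambda>x. win_prob N u (turn a t {u, x} h))" if u: "u \<in> ?A" for u
  proof -
    have "base u + 2 * \<kappa> / ?g - ((2 + 2 / \<rho> + 2 * \<kappa>) / ?g) * blocking h u (?P u)
      = (base u + 2 * \<kappa> / ?g)
        + ((base u - (2 + 2 / \<rho>) / ?g) - (base u + 2 * \<kappa> / ?g)) * blocking h u (?P u)"
      by (simp add: add_divide_distrib algebra_simps)
    also have "\<dots> = avg (?P u) (\<lambda>x. if {u, x} \<in> breaker_edges h
        then base u - (2 + 2 / \<rho>) / ?g else base u + 2 * \<kappa> / ?g)"
      using P[OF u] by (intro avg_outcome[symmetric]) auto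
    also have "\<dots> \<le> avg (?P u) (\<lambda>x. win_prob N u (turn a t {u, x} h))"
      by (rule avg_mono) (use fail[OF u] succ[OF u] in auto)
    finally show ?thesis .
  qed
  then have "avg ?A (\<lambda>u. base u + 2 * \<kappa> / ?g - ((2 + 2 / \<rho> + 2 * \<kappa>) / ?g) * blocking h u (?P u))
      \<le> avg ?A (\<lambda>u. avg (?P u) (\<lambda>x. win_prob N u (turn a t {u, x} h)))"
    by (rule avg_mono)
  also have "\<dots> = win_prob (Suc N) m h"
    using win_prob_pick[OF K ne P] by simp
  finally have "avg ?A (\<lambda>u. base u + 2 * \<kappa> / ?g - ((2 + 2 / \<rho> + 2 * \<kappa>) / ?g) * blocking h u (?P u))
      \<le> win_prob (Suc N) m h" .
  moreover have "avg ?A (\<lambda>u. base u + 2 * \<kappa> / ?g - ((2 + 2 / \<rho> + 2 * \<kappa>) / ?g) * blocking h u (?P u))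
    = (E - \<theta> * ?S * w - cost h / ?g + 2 * \<kappa> / ?g) + \<theta> * w * ?c
      - ((2 + 2 / \<rho> + 2 * \<kappa>) / ?g) * avg ?A (\<lambda>u. blocking h u (?P u))"
  proof -
    have linear: "avg ?A (\<lambda>u. y * f u - z * g u) = y * avg ?A f - z * avg ?A g" for y z f g
      by (simp add: avg_def sum_subtractf diff_divide_distrib flip: sum_distrib_left)
    have "avg ?A (\<lambda>u. base u + 2 * \<kappa> / ?g - ((2 + 2 / \<rho> + 2 * \<kappa>) / ?g) * blocking h u (?P u)) =
      avg ?A (\<lambda>u. (E - \<theta> * ?S * w - cost h / ?g + 2 * \<kappa> / ?g) + 1 *
        (\<theta> * w * (if u \<in> Tg then 1 else 0) - ((2 + 2 / \<rho> + 2 * \<kappa>) / ?g) * blocking h u (?P u)))"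
      by (intro avg_cong) (simp add: base_def algebra_simps)
    also have "\<dots> = (E - \<theta> * ?S * w - cost h / ?g + 2 * \<kappa> / ?g) + 1 * avg ?A (\<lambda>u.
        \<theta> * w * (if u \<in> Tg then 1 else 0) - ((2 + 2 / \<rho> + 2 * \<kappa>) / ?g) * blocking h u (?P u))"
      by (rule avg_affine[OF ne])
    also have "avg ?A (\<lambda>u. \<theta> * w * (if u \<in> Tg then 1 else 0)
          - ((2 + 2 / \<rho> + 2 * \<kappa>) / ?g) * blocking h u (?P u)) =
        \<theta> * w * avg ?A (\<lambda>u. if u \<in> Tg then 1 else 0)
          - ((2 + 2 / \<rho> + 2 * \<kappa>) / ?g) * avg ?A (\<lambda>u. blocking h u (?P u))"
      by (rule linear)
    also have "avg ?A (\<lambda>u. if u \<in> Tg then 1 else 0) = ?c"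
      by (rule avg_indicator[OF ne(1)])
    finally show ?thesis by simp
  qed
  moreover have "((2 + 2 / \<rho> + 2 * \<kappa>) / ?g) * avg ?A (\<lambda>u. blocking h u (?P u)) \<le> 2 * \<kappa> / ?g"
  proof -
    have "(2 + 2 / \<rho>) * \<mu> \<le> (2 / \<rho> + 2 / \<rho>) * \<mu>"
      using \<rho>_bounds \<mu>_bounds by (intro mult_right_mono add_right_mono) (auto simp: field_simps)
    then have "(2 + 2 / \<rho>) * \<mu> \<le> \<kappa>" by (simp add: \<kappa>_def)
    moreover have "2 * \<kappa> * \<mu> \<le> \<kappa>" using \<kappa> \<mu>_bounds mult_left_mono[of \<mu> "1/2" "2 * \<kappa>"] by simp
    ultimately have "(2 + 2 / \<rho> + 2 * \<kappa>) * \<mu> \<le> 2 * \<kappa>" by (simp add: algebra_simps)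
    moreover have "(2 + 2 / \<rho> + 2 * \<kappa>) * avg ?A (\<lambda>u. blocking h u (?P u)) \<le> (2 + 2 / \<rho> + 2 * \<kappa>) * \<mu>"
      using pairing_blocking[OF valid dl small] \<rho>_bounds \<kappa> by (intro mult_left_mono) auto
    ultimately have "(2 + 2 / \<rho> + 2 * \<kappa>) * avg ?A (\<lambda>u. blocking h u (?P u)) \<le> 2 * \<kappa>" by linarith
    then have "((2 + 2 / \<rho> + 2 * \<kappa>) * avg ?A (\<lambda>u. blocking h u (?P u))) / ?g \<le> 2 * \<kappa> / ?g"
      by (rule divide_right_mono) simp
    then show ?thesis by (simp only: times_divide_eq_left)
  qed
  moreover have "\<theta> * ?S * w - \<theta> * w * ?c \<le> \<theta> * ?S * real (lack h) powr (- 1 / (4 * real k))"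
    using target_progress[OF Tg l4 \<theta>] by (simp add: w_def algebra_simps)
  moreover have "score E \<theta> Tg m h = E - \<theta> * ?S * real (lack h) powr (- 1 / (4 * real k)) - cost h / ?g"
    by (simp add: score_def target_def rest_def nrep)
  ultimately show ?thesis by linarith
qed

text \<open>
Optional stopping: a lower bound by the score on leaving the phase is a lower bound throughout. Time
cannot run out inside the phase without a waste of at least \<open>d / 2\<close>, for which the score is not
positive anyway.
\<close>

lemma pairing_phase:
  assumes D: "d \<le> D" and Tg: "Tg \<subseteq> {..<n}" and \<theta>: "0 \<le> \<theta>" and E: "E \<le> 1"
    and T: "k * n + d \<le> 2 * T"
    and exit: "\<And>N m h. state D Y Tg T N m h \<Longrightarrow> lack h < D \<Longrightarrow>
      score E \<theta> Tg m h \<le> win_prob N m h"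
    and st: "state D Y Tg T N m h"
  shows "score E \<theta> Tg m h \<le> win_prob N m h"
  using st
proof (induction N arbitrary: m h)
  case 0
  have finTg: "finite Tg" using Tg finite_subset by blast
  show ?case
  proof (cases "lack h < D")
    case True
    then show ?thesis by (rule exit[OF 0])
  next
    case False
    have "attempts h = T" using 0 by (simp add: state_def)
    moreover have "real (k * n + d) \<le> real (2 * T)" using T by (simp only: of_nat_le_iff)
    ultimately have "real d / 2 \<le> waste h" by (simp add: waste_def)
    then have "\<not> 0 < score E \<theta> Tg m h"
      using waste_small[OF 0 finTg \<theta> E] by fastforce
    then show ?thesis using win_prob_nonneg[of 0 m h] by linarith
  qed
next
  case (Suc N)
  consider "lack h < D" | "score E \<theta> Tg m h \<le> 0" | "D \<le> lack h" "0 < score E \<theta> Tg m h"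
    by linarith
  then show ?case
  proof cases
    case 1
    then show ?thesis by (rule exit[OF Suc.prems])
  next
    case 2
    then show ?thesis using win_prob_nonneg[of "Suc N" m h] by linarith
  next
    case 3
    then show ?thesis
      using repair_step[OF Suc.prems D _ Tg \<theta> E _ _ Suc.IH]
        pairing_step[OF Suc.prems D _ Tg \<theta> E _ _ Suc.IH] by blast
  qed
qed


text \<open>
Five attempts per missing unit leave an exponentially small risk, as \<open>2 * (5/6) ^ 5 \<le> 9/10\<close>.
\<close>

lemma spread_phase:
  assumes "valid h" "lack h < d" "5 * d \<le> N"
    and light: "\<And>v. v \<in> alive h \<Longrightarrow> 2 * (blocked h v + b * (5 * d)) \<le> n"
  shows "1 - (9/10) ^ d \<le> win_prob N m h"
proof -
  have "1 * hits (1 / (3 * real n)) (shortfall k (maker_edges h) {}) (5 * d)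
      - 2 ^ lack h * (5/6) ^ (5 * d + 0) \<le> win_prob (5 * d + 0) m h"
  proof (rule window[where D=d and T="attempts h + 5 * d" and Y=n])
    show "pairing n k d (maker_view h') m' = spread n k (maker_view h')" if "lack h' < d" for h' m'
      using that by (simp add: pairing_def owned_view)
    show "1 - 2 ^ lack h' * (5/6) ^ 0 \<le> win_prob 0 m' h'" for h' m'
      by (simp add: win_prob_0)
    show "blocked h v + b * (5 * d) \<le> n" if "v \<in> alive h - {}" for v
      using light[of v] that by simp
  qed (use assms n_large in auto)
  then have "1 - 2 ^ lack h * (5/6) ^ (5 * d) \<le> win_prob (5 * d) m h"
    by (simp add: shortfall_def)
  moreover have "2 ^ lack h * (5/6 :: real) ^ (5 * d) \<le> 2 ^ d * (5/6) ^ (5 * d)"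
    using assms(2) by (intro mult_right_mono power_increasing) auto
  moreover have "2 ^ d * (5/6 :: real) ^ (5 * d) \<le> (9/10) ^ d"
    by (rule power_decay) simp
  ultimately show ?thesis
    using win_prob_mono_time[OF assms(3), of m h] by linarith
qed

text \<open>
The scale \<open>\<theta> = d powr (1 / (4 * k))\<close> makes the target term at least \<open>1\<close> if a target is still needy when
the shortfall drops below \<open>d\<close>. So whenever the score is positive at that time, all targets
have been saved, no needy vertex has more than \<open>n / 4\<close> blocked edges, and spreading finishes.
\<close>

lemma late_phase:
  assumes Tg: "Tg \<subseteq> {..<n}" and bd: "40 * (b * d) \<le> n"
    and Y: "4 * (Y + real b * ((real k * real n + real d / 2) / 2)) \<le> real n"
    and st: "state d Y Tg (k * n + 6 * d) N m h"
  shows "score (1 - (9/10) ^ d) (real d powr (1 / (4 * real k))) Tg m h \<le> win_prob N m h"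
proof (rule pairing_phase[OF order_refl Tg _ _ _ _ st])
  have finTg: "finite Tg" using Tg finite_subset by blast
  let ?\<theta> = "real d powr (1 / (4 * real k))" and ?E = "1 - (9/10 :: real) ^ d"
  show "0 \<le> ?\<theta>" by simp
  show "?E \<le> 1" by simp
  show "k * n + d \<le> 2 * (k * n + 6 * d)" by simp
  fix N m h
  assume st: "state d Y Tg (k * n + 6 * d) N m h" and lack: "lack h < d"
  then have nrep: "\<not> repairing h" by (auto simp: state_def)
  have valid: "valid h" using st by (simp add: state_def)
  show "score ?E ?\<theta> Tg m h \<le> win_prob N m h"
  proof (cases "0 < score ?E ?\<theta> Tg m h")
    case False
    then show ?thesis using win_prob_nonneg[of N m h] by linarith
  next
    case pos: True
    have small: "waste h < real d / 2"
      by (rule waste_small[OF st finTg _ _ pos]) auto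
    have "shortfall k (maker_edges h) Tg = 0"
    proof (rule ccontr)
      assume "shortfall k (maker_edges h) Tg \<noteq> 0"
      then have S: "1 \<le> target Tg m h" by (simp add: target_def nrep)
      have lack0: "0 < rest h" using st d_large(1) by (simp add: state_def rest_def nrep)
      have "?\<theta> * 1 * real d powr (- 1 / (4 * real k)) \<le> ?\<theta> * target Tg m h * rest h powr (- 1 / (4 * real k))"
        by (rule weight_le) (use S lack0 lack in \<open>auto simp: rest_def nrep\<close>)
      moreover have "?\<theta> * 1 * real d powr (- 1 / (4 * real k)) = 1"
        using d_pos by (simp flip: powr_add)
      moreover have "0 \<le> cost h / (real d / 2)"
        using state_nonneg(2)[OF st finTg] by simp
      moreover have "?E \<le> 1" by simp
      ultimately show False using pos unfolding score_def by linarith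
    qed
    then have disj: "alive h \<inter> Tg = {}"
      using shortfall_eq_0_iff[OF finTg, of k "maker_edges h"] by (force simp: needy_def)
    have att: "real (attempts h) \<le> (real k * real n + real d / 2) / 2"
      using small by (simp add: waste_def)
    have "2 * (blocked h v + b * (5 * d)) \<le> n" if v: "v \<in> alive h" for v
    proof -
      have "real (blocked h v) \<le> Y + real b * real (attempts h)"
        using st v disj by (auto simp: state_def)
      moreover have "real b * real (attempts h) \<le> real b * ((real k * real n + real d / 2) / 2)"
        using att by (intro mult_left_mono) auto
      ultimately have "real (blocked h v) \<le> Y + real b * ((real k * real n + real d / 2) / 2)"
        by (meson add_left_mono order_trans)
      then have "4 * real (blocked h v) \<le> 4 * (Y + real b * ((real k * real n + real d / 2) / 2))"
        by (rule mult_left_mono) simp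
      also note Y
      finally have "4 * real (blocked h v) \<le> real n" .
      then have "4 * blocked h v \<le> n" by linarith
      then show ?thesis using bd by simp
    qed
    moreover have "5 * d \<le> N"
    proof -
      have "real (attempts h) \<le> real (k * n + d)" using att by simp
      then have "attempts h \<le> k * n + d" by (simp only: of_nat_le_iff)
      moreover have "attempts h + N = k * n + 6 * d" using st by (simp add: state_def)
      ultimately show ?thesis by linarith
    qed
    ultimately have "?E \<le> win_prob N m h"
      using spread_phase[OF valid lack] by blast
    moreover have "score ?E ?\<theta> Tg m h \<le> ?E - cost h / (real d / 2)"
      by (rule score_le[OF st finTg]) simp
    moreover have "0 \<le> cost h / (real d / 2)"
      using state_nonneg(2)[OF st finTg] by simp
    ultimately show ?thesis by linarith
  qed
qed

text \<open>
In the early phase there are no targets: PhantomBreaker simply has too few edges to isolate a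
vertex. When the shortfall drops below \<open>d1\<close>, the at most \<open>16\<close> vertices with more than \<open>n / 8\<close> blocked
edges become the targets of the late phase, during which no other vertex gets endangered. As the
shortfall falls from \<open>d1\<close> to \<open>d\<close>, a target remains needy with probability of order
\<open>(d / d1) powr (1 / (4 * k))\<close>.
\<close>

lemma win_prob_pairing:
  assumes "b > 0" "8 \<le> d1" "d \<le> d1" "8 * (b * d1) \<le> n" "40 * (b * d) \<le> n"
  shows "1 - (9/10) ^ d - 16 * real k * (2 * real d / real d1) powr (1 / (4 * real k))
      - 128 * real k ^ 4 * real n ^ 3 / real d ^ 4 \<le> win_prob (k * n + 6 * d) 0 []"
proof -
  define \<epsilon> where "\<epsilon> = 16 * real k * (2 * real d / real d1) powr (1 / (4 * real k))"
  define E where "E = 1 - (9/10) ^ d - \<epsilon>"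
  let ?T = "k * n + 6 * d" and ?\<theta> = "real d powr (1 / (4 * real k))"
  have \<epsilon>: "0 \<le> \<epsilon>" by (simp add: \<epsilon>_def)
  have E: "E \<le> 1"
    using \<epsilon> zero_le_power[of "9/10 :: real" d] unfolding E_def by linarith
  have "d1 \<le> 8 * (b * d1)" using assms(1) by (cases b) auto
  then have d1n: "d1 \<le> n" using assms(4) by linarith
  have "score E 0 {} 0 [] \<le> win_prob ?T 0 []"
  proof (rule pairing_phase[where D=d1 and Y=0 and T="?T"])
    have "n \<le> k * n" using k_pos by simp
    then have "d1 \<le> k * n" using d1n by linarith
    then show "state d1 0 {} ?T ?T 0 []"
      by (simp add: state_def valid_Nil shortfall_empty repairing_def failed_def
          breaker_edges_def edge_degree_def)
    fix N m h
    assume st: "state d1 0 {} ?T N m h" and lack: "lack h < d1"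
    have valid: "valid h" using st by (simp add: state_def)
    show "score E 0 {} m h \<le> win_prob N m h"
    proof (cases "0 < score E 0 {} m h")
      case False
      then show ?thesis using win_prob_nonneg[of N m h] by linarith
    next
      case pos: True
      have small: "waste h < real d / 2"
        by (rule waste_small[OF st _ _ E pos]) auto
      have lack_ge: "d1 \<le> lack h + 2" using st by (simp add: state_def)
      have "waste h \<le> real (lack h)"
        using small lack_ge assms(2,3) by linarith
      then have B: "real (card (breaker_edges h)) \<le> real n"
        by (rule card_breaker_le_n[OF valid])
      \<comment> \<open>PhantomBreaker may know these vertices, but Maker does not and need not\<close>
      define Tg where "Tg = {v. v < n \<and> real (blocked h v) > real n / 8}"
      have Tg: "Tg \<subseteq> {..<n}" by (auto simp: Tg_def)
      have "real (card Tg) \<le> 2 * real (card (breaker_edges h)) / (real n / 8)"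
        unfolding Tg_def by (rule few_heavily_blocked[OF valid]) (use n_pos in simp)
      also have "\<dots> \<le> 16" using B n_pos by (simp add: field_simps)
      finally have card: "card Tg \<le> 16" by simp
      have "shortfall k (maker_edges h) Tg \<le> (\<Sum>v\<in>Tg. k)"
        unfolding shortfall_def by (rule sum_mono) simp
      also have "\<dots> \<le> 16 * k" using card by simp
      finally have "target Tg m h \<le> 16 * real k" by (simp add: target_def)
      define Y where "Y = real n / 8 - real b * real (attempts h)"
      have st2: "state d Y Tg ?T N m h"
        using st assms(3) by (auto simp: state_def Y_def Tg_def needy_def)
      have "score (1 - (9/10) ^ d) ?\<theta> Tg m h \<le> win_prob N m h"
      proof (rule late_phase[OF Tg assms(5) _ st2])
        have "real (k * n) \<le> real (lack h + 2 * attempts h)"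
          using st by (simp only: state_def of_nat_le_iff)
        then have "real k * real n \<le> real (lack h) + 2 * real (attempts h)" by simp
        moreover have "real (lack h) \<le> real d1" "real d \<le> real d1" using lack assms(3) by auto
        ultimately have "(real k * real n + real d / 2) / 2 - real (attempts h) \<le> real d1"
          using of_nat_0_le_iff[of d1, where 'a=real] by argo
        then have "real b * ((real k * real n + real d / 2) / 2 - real (attempts h)) \<le> real b * real d1"
          by (intro mult_left_mono) auto
        then have "real b * ((real k * real n + real d / 2) / 2) - real b * real (attempts h) \<le> real b * real d1"
          by (simp only: right_diff_distrib)
        moreover have "8 * (real b * real d1) \<le> real n"
          using of_nat_mono[OF assms(4), where 'a=real] by simp
        moreover have "4 * (x / 8 - y + z) \<le> x" if "z - y \<le> w" "8 * w \<le> x" for w x y z :: real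
          using that by argo
        ultimately show "4 * (Y + real b * ((real k * real n + real d / 2) / 2)) \<le> real n"
          unfolding Y_def by blast
      qed
      moreover have "?\<theta> * target Tg m h * rest h powr (- 1 / (4 * real k)) \<le> \<epsilon>"
      proof -
        have "?\<theta> * target Tg m h * rest h powr (- 1 / (4 * real k))
            \<le> ?\<theta> * (16 * real k) * (real d1 / 2) powr (- 1 / (4 * real k))"
        proof (rule weight_le)
          show "0 \<le> target Tg m h"
            using state_nonneg(3)[OF st2] Tg finite_subset by blast
          show "real d1 / 2 \<le> rest h" using lack_ge assms(2) by (simp add: rest_def)
        qed (use \<open>target Tg m h \<le> 16 * real k\<close> assms(2) in auto)
        also have "\<dots> = \<epsilon>"
          using assms(2) d_pos
          by (simp add: \<epsilon>_def powr_divide powr_mult powr_minus field_simps)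
        finally show ?thesis .
      qed
      moreover have "score E 0 {} m h = E - cost h / (real d / 2)"
        by (simp add: score_def)
      ultimately show ?thesis unfolding score_def E_def by linarith
    qed
  qed (use assms E in auto)
  moreover have "score E 0 {} 0 [] = E - 128 * real k ^ 4 * real n ^ 3 / real d ^ 4"
  proof -
    have "cost [] = 4 * \<mu> / \<rho> * (real k * real n)"
      by (simp add: cost_def waste_def shortfall_empty repairing_def failed_def)
    then have "cost [] / (real d / 2) = 128 * real k ^ 4 * real n ^ 3 / real d ^ 4"
      using d_pos k_pos n_pos by (simp add: \<mu>_def \<rho>_def field_simps power_numeral_reduce)
    then show ?thesis by (simp add: score_def)
  qed
  ultimately show ?thesis by (simp add: E_def \<epsilon>_def)
qed

end

section \<open>Winning asymptotically almost surely\<close>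

text \<open>
The order of the choices: \<open>d1\<close> is the fraction \<open>1 / (8 * b)\<close> of \<open>n\<close>, short enough for the late phase;
then \<open>d\<close> is a much smaller fraction \<open>1 / p\<close> of \<open>n\<close>, so that the targets are saved; then \<open>n\<close> is so large
that the expected waste, which is bounded in terms of \<open>p\<close> and \<open>k\<close>, is small against \<open>d\<close>.
\<close>

lemma win_with_probability_near_1:
  fixes \<epsilon> :: real
  assumes "a > 0" "b > 0" "k > 0" and bias: "b * k \<le> 2 * a" and \<epsilon>: "0 < \<epsilon>"
  shows "\<exists>n0. \<forall>n\<ge>n0. \<exists>\<sigma>\<in>randomized_maker_strategies n. \<forall>\<tau>\<in>randomized_breaker_strategies n b.
    1 - \<epsilon> \<le> maker_win_prob (mindegree_family n k) a \<sigma> \<tau>"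
proof -
  define \<eta> where "\<eta> = \<epsilon> / (48 * real k)"
  have \<eta>: "0 < \<eta>" using assms by (simp add: \<eta>_def)
  define p where "p = nat \<lceil>32 * real b / \<eta> ^ (4 * k)\<rceil> + 40 * b"
  have p: "0 < p" "8 * b \<le> p" "40 * b \<le> p" using assms(2) by (auto simp: p_def)
  have "32 * real b / \<eta> ^ (4 * k) \<le> real p" unfolding p_def by linarith
  then have p_ge: "32 * real b / real p \<le> \<eta> ^ (4 * k)"
    using \<eta> p(1) by (simp add: field_simps)
  obtain n1 where n1: "\<And>n. n \<ge> n1 \<Longrightarrow> (9/10) ^ n \<le> \<epsilon> / 3"
    using eventually_power_small[of "\<epsilon> / 3"] \<epsilon> by auto
  define n0 where "n0 = max (p * n1) (max (p * 4) (max (p * (4 * (k * k))) (max (32 * p ^ 2 * k ^ 2)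
    (max (4 * k + 1) (max p (max (64 * b) (nat \<lceil>6144 * real k ^ 4 * real p ^ 4 / \<epsilon>\<rceil>)))))))"
  have "\<exists>\<sigma>\<in>randomized_maker_strategies n. \<forall>\<tau>\<in>randomized_breaker_strategies n b.
    1 - \<epsilon> \<le> maker_win_prob (mindegree_family n k) a \<sigma> \<tau>" if "n \<ge> n0" for n
  proof -
    have n: "p * n1 \<le> n" "p * 4 \<le> n" "p * (4 * (k * k)) \<le> n" "32 * p ^ 2 * k ^ 2 \<le> n"
      "4 * k + 1 \<le> n" "p \<le> n" "64 * b \<le> n" "nat \<lceil>6144 * real k ^ 4 * real p ^ 4 / \<epsilon>\<rceil> \<le> n"
      using that by (simp_all only: n0_def max.bounded_iff)
    define d where "d = n div p"
    define d1 where "d1 = n div (8 * b)"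
    have div: "x \<le> d" if "p * x \<le> n" for x
      using div_le_mono[OF that, of p] p(1) by (simp add: d_def)
    have d: "n1 \<le> d" "4 \<le> d" "4 * (k * k) \<le> d" using div n by auto
    have nd: "n \<le> 2 * p * d" using nat_div_ge_half[OF p(1) n(6)] by (simp add: d_def)
    have nd1: "n \<le> 16 * b * d1"
      using nat_div_ge_half[of "8 * b" n] assms(2) n(7) by (simp add: d1_def)
    have pd: "p * d \<le> n" by (simp add: d_def)
    have "n * (32 * p ^ 2 * k ^ 2) \<le> n * n" using n(4) by simp
    also have "\<dots> \<le> (2 * p * d) * (2 * p * d)" using nd by (intro mult_mono) auto
    finally have "(4 * p ^ 2) * (8 * (n * (k * k))) \<le> (4 * p ^ 2) * (d * d)"
      by (simp add: power2_eq_square mult_ac)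
    then have d2: "8 * (n * (k * k)) \<le> d * d" using p(1) by (simp add: mult_ac)
    have dn: "d \<le> n" by (simp add: d_def)
    have small: "128 * real k ^ 4 * real n ^ 3 / real d ^ 4 \<le> \<epsilon> / 3"
    proof -
      have dpos: "0 < real d" "0 < real n" using d(2) dn by auto
      have "real n \<le> real (2 * p * d)" using nd by (simp only: of_nat_le_iff)
      then have "real n ^ 4 \<le> (2 * real p * real d) ^ 4" by (intro power_mono) auto
      then have "128 * real k ^ 4 * real n ^ 4 \<le> 128 * real k ^ 4 * (2 * real p * real d) ^ 4"
        by (intro mult_left_mono) auto
      moreover have "(128 * real k ^ 4 * real n ^ 3) * real n = 128 * real k ^ 4 * real n ^ 4"
        by (simp add: power_numeral_reduce)
      moreover have "128 * real k ^ 4 * (2 * real p * real d) ^ 4 = (2048 * real k ^ 4 * real p ^ 4) * real d ^ 4"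
        by (simp add: power_mult_distrib)
      ultimately have "(128 * real k ^ 4 * real n ^ 3) * real n \<le> (2048 * real k ^ 4 * real p ^ 4) * real d ^ 4"
        by linarith
      then have "128 * real k ^ 4 * real n ^ 3 / real d ^ 4 \<le> 2048 * real k ^ 4 * real p ^ 4 / real n"
        using dpos frac_le_eq by (simp add: divide_le_eq le_divide_eq mult.commute)
      also have "\<dots> \<le> \<epsilon> / 3"
      proof -
        have "6144 * real k ^ 4 * real p ^ 4 / \<epsilon> \<le> real n" using n(8) by linarith
        then show ?thesis using dpos \<epsilon> by (simp add: field_simps)
      qed
      finally show ?thesis .
    qed
    have target: "16 * real k * (2 * real d / real d1) powr (1 / (4 * real k)) \<le> \<epsilon> / 3"
    proof -
      have d1pos: "0 < real d1" using nd1 n(6) p(1) by (cases d1) auto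
      have "real (p * d) \<le> real (16 * b * d1)" using pd nd1 by linarith
      then have "2 * real d / real d1 \<le> 32 * real b / real p"
        using d1pos p(1) by (simp add: field_simps)
      then have "2 * real d / real d1 \<le> \<eta> ^ (4 * k)" using p_ge by linarith
      then have "(2 * real d / real d1) powr (1 / (4 * real k)) \<le> (\<eta> ^ (4 * k)) powr (1 / (4 * real k))"
        using d1pos by (intro powr_mono2) auto
      also have "\<dots> = \<eta>"
        using \<eta> assms(3) by (simp add: powr_powr flip: powr_realpow)
      finally have "16 * real k * (2 * real d / real d1) powr (1 / (4 * real k)) \<le> 16 * real k * \<eta>"
        by (intro mult_left_mono) auto
      also have "\<dots> = \<epsilon> / 3" using assms(3) by (simp add: \<eta>_def)
      finally show ?thesis .
    qed
    show ?thesis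
    proof (rule randomized_strategy_from_kernel[where K="pairing n k d" and m=0])
      show "n \<ge> 2" using n(5) assms(3) by simp
      have "k * k > 0" using assms(3) by simp
      then have kd: "k * k < d" using d(3) by linarith
      show "legal n w e" if "(e, m') \<in> set_pmf (pairing n k d w m)" for w m e m'
        by (rule legal_pairing[OF _ _ kd that]) (use n(5) assms(3) in auto)
      fix t assume t: "t \<in> breaker_strategies n b"
      interpret pairing_game n a b k t d
        using assms n t d d2 dn by unfold_locales auto
      have "1 - (9/10) ^ d - 16 * real k * (2 * real d / real d1) powr (1 / (4 * real k))
          - 128 * real k ^ 4 * real n ^ 3 / real d ^ 4 \<le> win_prob (k * n + 6 * d) 0 []"
      proof (rule win_prob_pairing)
        show "8 \<le> d1"
          using div_le_mono[OF n(7), of "8 * b"] assms(2) by (simp add: d1_def)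
        show "d \<le> d1" using p(2) assms(2) by (simp add: d_def d1_def div_le_mono2)
        show "8 * (b * d1) \<le> n" by (simp add: d1_def flip: mult.assoc)
        have "40 * (b * d) \<le> p * d"
          using mult_le_mono1[OF p(3), of d] by (simp only: mult.assoc)
        then show "40 * (b * d) \<le> n" using pd by (rule order_trans)
      qed (use assms in auto)
      then show "1 - \<epsilon> \<le> measure_pmf.prob (chain a t (pairing n k d) (k * n + 6 * d) 0 []) (finished n k)"
        using n1[OF d(1)] small target unfolding win_prob_def by linarith
    qed (use assms in auto)
  qed
  then show ?thesis by blast
qed

text \<open>
The strategies obtained so far depend on the permitted error. A diagonal choice removes this
dependence; since the best success probability need not be attained, \<open>1 / (n + 1)\<close> is given away.
\<close>

lemma near_optimal_strategies:
  fixes P :: "nat \<Rightarrow> real \<Rightarrow> bool"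
  assumes near: "\<And>\<epsilon>. 0 < \<epsilon> \<Longrightarrow> \<exists>n0. \<forall>n\<ge>n0. P n (1 - \<epsilon>)"
    and down: "\<And>n x y. P n x \<Longrightarrow> y \<le> x \<Longrightarrow> P n y"
  shows "\<exists>p. p \<longlonglongrightarrow> 1 \<and> (\<exists>n0. \<forall>n\<ge>n0. P n (p n))"
proof -
  define S where "S = (\<lambda>n. {x. 0 \<le> x \<and> x \<le> 1 \<and> P n x})"
  define p where "p = (\<lambda>n. Sup (S n) - 1 / real (Suc n))"
  obtain n0 where n0: "\<And>n. n \<ge> n0 \<Longrightarrow> P n 0" using near[of 1] by auto
  have bdd: "bdd_above (S n)" for n by (rule bdd_aboveI[of _ 1]) (auto simp: S_def)
  have S0: "0 \<in> S n" if "n \<ge> n0" for n using n0[OF that] by (simp add: S_def)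
  have "P n (p n)" if n: "n \<ge> n0" for n
  proof -
    have "p n < Sup (S n)" by (simp add: p_def)
    then obtain x where "x \<in> S n" "p n < x"
      using less_cSup_iff[OF _ bdd, of n "p n"] S0[OF n] by auto
    then show ?thesis using down[of n x "p n"] by (simp add: S_def)
  qed
  moreover have "p \<longlonglongrightarrow> 1"
  proof -
    have "(\<lambda>n. Sup (S n)) \<longlonglongrightarrow> 1"
    proof (rule LIMSEQ_I)
      fix r :: real assume r: "0 < r"
      define \<epsilon> where "\<epsilon> = min (r / 2) 1"
      have \<epsilon>: "0 < \<epsilon>" "\<epsilon> \<le> 1" "\<epsilon> < r" using r by (auto simp: \<epsilon>_def)
      obtain n2 where n2: "\<And>n. n \<ge> n2 \<Longrightarrow> P n (1 - \<epsilon>)" using near[OF \<epsilon>(1)] by auto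
      have "norm (Sup (S n) - 1) < r" if "n \<ge> n2" for n
      proof -
        have mem: "1 - \<epsilon> \<in> S n" using n2[OF that] \<epsilon> by (simp add: S_def)
        then have "1 - \<epsilon> \<le> Sup (S n)" by (rule cSup_upper[OF _ bdd])
        moreover have "S n \<noteq> {}" using mem by blast
        then have "Sup (S n) \<le> 1" by (rule cSup_least) (simp add: S_def)
        ultimately show ?thesis using \<epsilon> by simp
      qed
      then show "\<exists>no. \<forall>n\<ge>no. norm (Sup (S n) - 1) < r" by blast
    qed
    then have "(\<lambda>n. Sup (S n) - 1 / real (Suc n)) \<longlonglongrightarrow> 1 - 0"
      by (intro tendsto_diff) (use LIMSEQ_inverse_real_of_nat in \<open>simp_all add: inverse_eq_divide\<close>)
    then show ?thesis by (simp add: p_def)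
  qed
  ultimately show ?thesis by blast
qed

theorem theorem3:
  fixes a b k :: nat
  assumes "a > 0" and "b > 0" and "k > 0"
  shows "(real b > 2 * real a / real k \<longrightarrow>
           (\<exists>c::real. c > 0 \<and> (\<exists>n0. \<forall>n\<ge>n0.
              \<exists>\<sigma>\<in>randomized_maker_strategies n. \<forall>\<tau>\<in>randomized_breaker_strategies n b.
                maker_win_prob (mindegree_family n k) a \<sigma> \<tau> \<ge> c)))
       \<and> (real b \<le> 2 * real a / real k \<longrightarrow>
           (\<exists>p :: nat \<Rightarrow> real. p \<longlonglongrightarrow> 1 \<and> (\<exists>n0. \<forall>n\<ge>n0.
              \<exists>\<sigma>\<in>randomized_maker_strategies n. \<forall>\<tau>\<in>randomized_breaker_strategies n b.
                maker_win_prob (mindegree_family n k) a \<sigma> \<tau> \<ge> p n)))"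
proof (intro conjI impI)
  show "\<exists>c::real. c > 0 \<and> (\<exists>n0. \<forall>n\<ge>n0.
      \<exists>\<sigma>\<in>randomized_maker_strategies n. \<forall>\<tau>\<in>randomized_breaker_strategies n b.
        maker_win_prob (mindegree_family n k) a \<sigma> \<tau> \<ge> c)"
    by (rule positive_probability[OF assms])
next
  assume "real b \<le> 2 * real a / real k"
  then have "real (b * k) \<le> real (2 * a)" using assms(3) by (simp add: field_simps)
  then have bias: "b * k \<le> 2 * a" by (simp only: of_nat_le_iff)
  show "\<exists>p :: nat \<Rightarrow> real. p \<longlonglongrightarrow> 1 \<and> (\<exists>n0. \<forall>n\<ge>n0.
      \<exists>\<sigma>\<in>randomized_maker_strategies n. \<forall>\<tau>\<in>randomized_breaker_strategies n b.
        maker_win_prob (mindegree_family n k) a \<sigma> \<tau> \<ge> p n)"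
    by (rule near_optimal_strategies[where P="\<lambda>n x.
        \<exists>\<sigma>\<in>randomized_maker_strategies n. \<forall>\<tau>\<in>randomized_breaker_strategies n b.
          x \<le> maker_win_prob (mindegree_family n k) a \<sigma> \<tau>"])
      (use win_with_probability_near_1[OF assms bias] in \<open>blast intro: order_trans\<close>)+
qed

end
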